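(* Suppose $\mathcal{A}=\{a_1,\ldots,a_{n+2}\}\subset\mathbb{R}^n$ is a non-degenerate circuit (of cardinality $n+2$), and let $b:=(b_1,\ldots,b_{n+2})$, where $b_i$ is $(-1)^i$ times the determinant of the $(n+1)\times(n+1)$ matrix with columns $(1,a_1),\ldots,\widehat{(1,a_i)},\ldots,(1,a_{n+2})$ (the hat denoting omission). Then: 1. The generalized $\mathcal{A}$-discriminant variety satisfies $$\nabla_{\mathcal{A}}\subseteq\left\{[c_1:\cdots:c_{n+2}]\in\mathbb{P}^{n+1}_{\mathbb{C}}\;:\;\prod_{i=1}^{n+2}\left|\frac{c_i}{b_i}\right|^{b_i}=1\right\}.$$ Also, $(b_1,\ldots,b_{n+2})$ can be computed in $\mathbf{NC}^2_{\mathbb{R}}$. 2. For $[c_1:\cdots:c_{n+2}]\in\mathbb{P}^{n+1}_{\mathbb{R}}$, the two conditions (i) $\mathrm{sign}(c_1b_1)=\cdots=\mathrm{sign}(c_{n+2}b_{n+2})$ and (ii) $\prod_{i=1}^{n+2}\left(\mathrm{sign}(b_ic_i)\,c_i/b_i\right)^{\mathrm{sign}(b_ic_i)\,b_i}=1$ both hold if and only if the real zero set of $g(y):=\sum_{i=1}^{n+2}c_ie^{a_i\cdot y}$ contains a degenerate point $\zeta$. In particular, any such $\zeta$ satisfies $e^{a_i\cdot\zeta}=\mathrm{sign}(b_1c_1)\,b_i/c_i$ for all $i$, and thus the real zero set of $g$ has at most one degenerate point.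
   Context: A finite set $\mathcal{A}\subset\mathbb{R}^n$ is a *(non-degenerate) circuit* iff $\mathcal{A}$ is affinely dependent but every proper subset of $\mathcal{A}$ is affinely independent. A *degenerate* root (or degenerate point of the zero set) of $g$ is a point where $g$ and all of its first-order partial derivatives vanish. The real zero set of $g$ is its zero set in $\mathbb{R}^n$. For $\mathcal{A}=\{a_1,\ldots,a_m\}\subset\mathbb{R}^n$ of cardinality $m$, the *generalized $\mathcal{A}$-discriminant variety* $\nabla_{\mathcal{A}}\subset\mathbb{P}^{m-1}_{\mathbb{C}}$ is the closure of the set of all $[c_1:\cdots:c_m]\in\mathbb{P}^{m-1}_{\mathbb{C}}$, with all $c_i\in\mathbb{C}\setminus\{0\}$, such that $\sum_{i=1}^mc_ie^{a_i\cdot y}$ has a degenerate root $y\in\mathbb{C}^n$. Convention: at points where some $c_i=0$, the equation $\prod_i|c_i/b_i|^{b_i}=1$ is understood with negative exponents cleared, i.e. as $\prod_{b_i>0}|c_i/b_i|^{b_i}=\prod_{b_i<0}|c_i/b_i|^{-b_i}$. $\mathbf{NC}^2_{\mathbb{R}}$ is the family of real-valued functions of real inputs computable by arithmetic circuits (over $\mathbb{R}$) with size polynomial in the input size and depth $O(\log^2(\text{input size}))$; here the input is $\mathcal{A}$.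
   Formalization: The formula e^{a_i·ζ} = sign(b_1c_1) b_i/c_i is not invariant under rescaling c and fails for general c; it is proved for a suitable positive multiple tc of c, i.e. for some representative of the point [c_1:…:c_{n+2}]. *)

theory Defs
  imports
    "HOL-Analysis.Function_Topology"
    "HOL-Library.Landau_Symbols"
    "Jordan_Normal_Form.Determinant"
begin

text \<open>
  Points of R^n and C^n are vectors in \<^term>\<open>carrier_vec n\<close>, so that the dimension is an
  ordinary natural number (the complexity claim is about all dimensions at once). All families
  are indexed from 0: the data written with index i = 1, ..., m on paper sits at i - 1 here.
\<close>

section \<open>Circuits of points\<close>

text \<open>
  The explicit form of affine_dependent from HOL-Analysis for finite sets (fact
  affine_dependent_explicit_finite); \<^typ>\<open>real Matrix.vec\<close> is not of class
  \<^class>\<open>real_vector\<close>.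
\<close>

definition affinely_dependent :: "nat \<Rightarrow> real Matrix.vec set \<Rightarrow> bool" where
  "affinely_dependent n S \<longleftrightarrow>
     (\<exists>u. (\<Sum>x\<in>S. u x) = 0 \<and> (\<exists>x\<in>S. u x \<noteq> 0) \<and> (\<forall>j<n. (\<Sum>x\<in>S. u x * x $ j) = 0))"

definition nondegenerate_circuit :: "nat \<Rightarrow> real Matrix.vec set \<Rightarrow> bool" where
  "nondegenerate_circuit n A \<longleftrightarrow>
     finite A \<and> A \<subseteq> carrier_vec n \<and> affinely_dependent n A \<and>
     (\<forall>B. B \<subset> A \<longrightarrow> \<not> affinely_dependent n B)"

text \<open>
  The sign is (-1) to the power i + 1 because of the index shift.
\<close>

definition circuit_coeff :: "nat \<Rightarrow> (nat \<Rightarrow> real Matrix.vec) \<Rightarrow> nat \<Rightarrow> real" where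
  "circuit_coeff n a i =
     (-1) ^ (i + 1) *
     det (mat_of_cols (n + 1) (map (\<lambda>j. vCons 1 (a j)) (filter (\<lambda>j. j \<noteq> i) [0..<n + 2])))"

section \<open>Exponential sums and degenerate roots\<close>

definition exp_sum ::
    "(nat \<Rightarrow> real Matrix.vec) \<Rightarrow> 'k::{real_normed_field,banach} Matrix.vec \<Rightarrow> 'k Matrix.vec \<Rightarrow> 'k" where
  "exp_sum a c y = (\<Sum>i<dim_vec c. c $ i * exp (scalar_prod (map_vec of_real (a i)) y))"

definition degenerate_root ::
    "nat \<Rightarrow> ('k::real_normed_field Matrix.vec \<Rightarrow> 'k) \<Rightarrow> 'k Matrix.vec \<Rightarrow> bool" where
  "degenerate_root n g y \<longleftrightarrow>
     y \<in> carrier_vec n \<and> g y = 0 \<and>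
     (\<forall>j<n. ((\<lambda>t. g (Matrix.vec n (\<lambda>k. if k = j then t else y $ k)))
              has_field_derivative 0) (at (y $ j)))"

section \<open>Complex projective space and the generalized discriminant variety\<close>

definition nonzero_vecs :: "nat \<Rightarrow> 'k::zero Matrix.vec set" where
  "nonzero_vecs m = carrier_vec m - {0\<^sub>v m}"

text \<open>A point of projective space is the set of its homogeneous coordinate vectors.\<close>

definition proj_point :: "complex Matrix.vec \<Rightarrow> complex Matrix.vec set" where
  "proj_point c = {t \<cdot>\<^sub>v c | t. t \<noteq> 0}"

definition proj_space :: "nat \<Rightarrow> complex Matrix.vec set set" where
  "proj_space m = proj_point ` nonzero_vecs m"

text \<open>
  The Euclidean topology on the nonzero vectors, and the resulting quotient topology on the
  projective space of complex dimension m - 1. The closure defining the discriminant variety is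
  taken in this topology: for non-integral exponents the set is not algebraic.
\<close>

definition nonzero_vecs_topology :: "nat \<Rightarrow> complex Matrix.vec topology" where
  "nonzero_vecs_topology m =
     pullback_topology (nonzero_vecs m) (\<lambda>v. restrict (vec_index v) {..<m})
       (product_topology (\<lambda>_. euclidean) {..<m})"

definition proj_topology :: "nat \<Rightarrow> complex Matrix.vec set topology" where
  "proj_topology m = topology (\<lambda>U. U \<subseteq> proj_space m \<and>
     openin (nonzero_vecs_topology m) {v \<in> nonzero_vecs m. proj_point v \<in> U})"

lemma topspace_nonzero_vecs_topology [simp]:
  "topspace (nonzero_vecs_topology m) = nonzero_vecs m"
  by (auto simp: nonzero_vecs_topology_def topspace_pullback_topology)

lemma openin_proj_topology:
  "openin (proj_topology m) U \<longleftrightarrow> U \<subseteq> proj_space m \<and>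
     openin (nonzero_vecs_topology m) {v \<in> nonzero_vecs m. proj_point v \<in> U}"
proof -
  have "istopology (\<lambda>U. U \<subseteq> proj_space m \<and>
     openin (nonzero_vecs_topology m) {v \<in> nonzero_vecs m. proj_point v \<in> U})"
    unfolding istopology_def
  proof (intro conjI allI impI)
    fix S T assume S: "S \<subseteq> proj_space m \<and>
        openin (nonzero_vecs_topology m) {v \<in> nonzero_vecs m. proj_point v \<in> S}"
      and T: "T \<subseteq> proj_space m \<and>
        openin (nonzero_vecs_topology m) {v \<in> nonzero_vecs m. proj_point v \<in> T}"
    show "S \<inter> T \<subseteq> proj_space m" using S by blast
    have "{v \<in> nonzero_vecs m. proj_point v \<in> S \<inter> T} =
        {v \<in> nonzero_vecs m. proj_point v \<in> S} \<inter> {v \<in> nonzero_vecs m. proj_point v \<in> T}"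
      by blast
    then show "openin (nonzero_vecs_topology m) {v \<in> nonzero_vecs m. proj_point v \<in> S \<inter> T}"
      using S T by (simp add: openin_Int)
  next
    fix K assume K: "\<forall>S\<in>K. S \<subseteq> proj_space m \<and>
        openin (nonzero_vecs_topology m) {v \<in> nonzero_vecs m. proj_point v \<in> S}"
    show "\<Union>K \<subseteq> proj_space m" using K by blast
    have "{v \<in> nonzero_vecs m. proj_point v \<in> \<Union>K} =
        (\<Union>S\<in>K. {v \<in> nonzero_vecs m. proj_point v \<in> S})"
      by blast
    then show "openin (nonzero_vecs_topology m) {v \<in> nonzero_vecs m. proj_point v \<in> \<Union>K}"
      using K by (auto intro!: openin_Union)
  qed
  then show ?thesis
    by (simp add: proj_topology_def topology_inverse')
qed

lemma topspace_proj_topology [simp]: "topspace (proj_topology m) = proj_space m"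
proof -
  have "{v \<in> nonzero_vecs m. proj_point v \<in> proj_space m} = topspace (nonzero_vecs_topology m)"
    by (auto simp: proj_space_def)
  then have "openin (proj_topology m) (proj_space m)"
    by (simp only: openin_proj_topology openin_topspace subset_refl simp_thms)
  then show ?thesis
    by (meson openin_proj_topology openin_subset openin_topspace subset_antisym)
qed

lemma quotient_map_proj_point:
  "quotient_map (nonzero_vecs_topology m) (proj_topology m) proj_point"
  by (auto simp: quotient_map_def openin_proj_topology proj_space_def)

definition gen_discriminant ::
    "nat \<Rightarrow> nat \<Rightarrow> (nat \<Rightarrow> real Matrix.vec) \<Rightarrow> complex Matrix.vec set set" where
  "gen_discriminant n m a =
     proj_topology m closure_of
       {proj_point c | c. c \<in> carrier_vec m \<and> (\<forall>i<m. c $ i \<noteq> 0) \<and>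
                          (\<exists>y. degenerate_root n (exp_sum a c) y)}"

text \<open>
  The equation in item 1; negative exponents are cleared at points with a vanishing coordinate
  (note that \<^prop>\<open>(0::real) powr x = 0\<close> for every x).
\<close>

definition disc_equation :: "(nat \<Rightarrow> real) \<Rightarrow> complex Matrix.vec \<Rightarrow> bool" where
  "disc_equation b c \<longleftrightarrow>
     (if \<forall>i<dim_vec c. c $ i \<noteq> 0
      then (\<Prod>i<dim_vec c. cmod (c $ i / of_real (b i)) powr b i) = 1
      else (\<Prod>i\<in>{i. i < dim_vec c \<and> b i > 0}. cmod (c $ i / of_real (b i)) powr b i) =
           (\<Prod>i\<in>{i. i < dim_vec c \<and> b i < 0}. cmod (c $ i / of_real (b i)) powr (- b i)))"

section \<open>Arithmetic circuits over the reals\<close>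

text \<open>
  A straight-line program: the natural numbers in \<open>AddG\<close>, \<open>SubG\<close>, \<open>MulG\<close> are
  positions of earlier gates, the one in \<open>InputG\<close> is the position of an input. There are no
  division or comparison gates.
\<close>

datatype gate = InputG nat | ConstG real | AddG nat nat | SubG nat nat | MulG nat nat

datatype arith_circuit = Arith_Circuit (gates: "gate list") (outputs: "nat list")

text \<open>N is the number of inputs and k the position of the gate.\<close>

fun wf_gate :: "nat \<Rightarrow> nat \<Rightarrow> gate \<Rightarrow> bool" where
  "wf_gate N k (InputG i) \<longleftrightarrow> i < N"
| "wf_gate N k (ConstG r) \<longleftrightarrow> True"
| "wf_gate N k (AddG p q) \<longleftrightarrow> p < k \<and> q < k"
| "wf_gate N k (SubG p q) \<longleftrightarrow> p < k \<and> q < k"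
| "wf_gate N k (MulG p q) \<longleftrightarrow> p < k \<and> q < k"

definition wf_circuit :: "nat \<Rightarrow> arith_circuit \<Rightarrow> bool" where
  "wf_circuit N C \<longleftrightarrow>
     (\<forall>k<length (gates C). wf_gate N k (gates C ! k)) \<and>
     (\<forall>k\<in>set (outputs C). k < length (gates C))"

text \<open>Here vs is the list of values, resp. depths, of the earlier gates.\<close>

fun gate_value :: "real list \<Rightarrow> real list \<Rightarrow> gate \<Rightarrow> real" where
  "gate_value xs vs (InputG i) = xs ! i"
| "gate_value xs vs (ConstG r) = r"
| "gate_value xs vs (AddG p q) = vs ! p + vs ! q"
| "gate_value xs vs (SubG p q) = vs ! p - vs ! q"
| "gate_value xs vs (MulG p q) = vs ! p * vs ! q"

fun gate_depth :: "nat list \<Rightarrow> gate \<Rightarrow> nat" where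
  "gate_depth vs (InputG i) = 0"
| "gate_depth vs (ConstG r) = 0"
| "gate_depth vs (AddG p q) = Suc (max (vs ! p) (vs ! q))"
| "gate_depth vs (SubG p q) = Suc (max (vs ! p) (vs ! q))"
| "gate_depth vs (MulG p q) = Suc (max (vs ! p) (vs ! q))"

definition circuit_eval :: "arith_circuit \<Rightarrow> real list \<Rightarrow> real list" where
  "circuit_eval C xs =
     map ((!) (foldl (\<lambda>vs g. vs @ [gate_value xs vs g]) [] (gates C))) (outputs C)"

definition circuit_size :: "arith_circuit \<Rightarrow> nat" where
  "circuit_size C = length (gates C)"

definition circuit_depth :: "arith_circuit \<Rightarrow> nat" where
  "circuit_depth C =
     Max (insert 0 (set (foldl (\<lambda>vs g. vs @ [gate_depth vs g]) [] (gates C))))"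

text \<open>
  \<open>NC_R k F\<close>: the partial function with graph F, mapping finite sequences of reals to
  finite sequences of reals, is computed by arithmetic circuits, one for each input size N (the
  number of real inputs), of size polynomial in N and depth O(log^k N).
\<close>

definition NC_R :: "nat \<Rightarrow> (real list \<times> real list) set \<Rightarrow> bool" where
  "NC_R k F \<longleftrightarrow>
     (\<exists>C :: nat \<Rightarrow> arith_circuit.
        (\<forall>N. wf_circuit N (C N)) \<and>
        (\<exists>d. (\<lambda>N. real (circuit_size (C N))) \<in> O(\<lambda>N. real N ^ d)) \<and>
        (\<lambda>N. real (circuit_depth (C N))) \<in> O(\<lambda>N. ln (real N) ^ k) \<and>
        (\<forall>(xs, zs)\<in>F. circuit_eval (C (length xs)) xs = zs))"

text \<open>
  The map sending a non-degenerate circuit of n + 2 points in R^n, listed coordinate by coordinate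
  (input size n (n + 2), n arbitrary), to its vector of coefficients.
\<close>

definition circuit_coeff_graph :: "(real list \<times> real list) set" where
  "circuit_coeff_graph =
     {(concat (map (\<lambda>i. list_of_vec (a i)) [0..<n + 2]), map (circuit_coeff n a) [0..<n + 2]) | n a.
        inj_on a {..<n + 2} \<and> nondegenerate_circuit n (a ` {..<n + 2})}"

end

theory Submission
  imports Defs "HOL-Computational_Algebra.Formal_Power_Series"
begin

text \<open>
  Up to a scalar, b is the only affine relation among the points, by Cramer's rule. A degenerate
  root y says that the numbers c_i exp(a_i y) form an affine relation, so they equal l b_i for some l.
  Taking absolute values and weighting by b_i, the contributions of l and of y cancel, which
  is the discriminant equation; it passes to the closure because its cleared form is a closed condition
  that is invariant under scaling. In the real case one conversely solves the linear system
  k + a_i z = ln (s b_i / c_i), whose only compatibility condition is the discriminant equation.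

  For the circuits, the minors are computed by Csanky's method: the powers of a matrix yield the
  power sums of its eigenvalues, Newton's identities form a triangular linear system for the
  coefficients of the characteristic polynomial, and this system is solved by powers of a nilpotent
  matrix. Matrix powers take O(log n) rounds of parallel matrix products of depth O(log n) each.
\<close>

section \<open>Determinants by Newton's identities\<close>

text \<open>Gates neither divide nor compare, so elimination with pivots is out, and cofactor
  expansion would be of exponential size. Csanky's method divides only by the integers k <= n + 1,
  whose inverses can be supplied as constants. On the geometric side everything is phrased with the
  homogenised points (1, a_i): the vanishing of g and of its n partial derivatives amounts to n + 1
  linear equations for the n + 2 numbers c_i exp(a_i y). Their solution space is the line spanned by
  b, and minimality of the circuit makes every b_i nonzero; this excludes vanishing c_i at a root
  and lets the last of the n + 2 logarithmic equations in the n + 1 unknowns k and z follow from the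
  others. The sign s is what makes the arguments of the logarithms positive. The multiplier l is
  exactly what projective coordinates leave undetermined: the formula for exp(a_i zeta) holds for a
  representative of c with |l| = 1, which explains the factor t.\<close>

lemma fps_deriv_prod:
  fixes f :: "'i \<Rightarrow> 'a::comm_ring_1 fps"
  assumes "finite I"
  shows "fps_deriv (\<Prod>i\<in>I. f i) = (\<Sum>i\<in>I. fps_deriv (f i) * (\<Prod>j\<in>I - {i}. f j))"
  using assms
proof induction
  case (insert x I)
  have "(\<Sum>i\<in>I. fps_deriv (f i) * (\<Prod>j\<in>insert x I - {i}. f j))
      = (\<Sum>i\<in>I. f x * (fps_deriv (f i) * (\<Prod>j\<in>I - {i}. f j)))"
  proof (rule sum.cong)
    fix i assume i: "i \<in> I"
    then have "insert x I - {i} = insert x (I - {i})" using insert.hyps by auto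
    then show "fps_deriv (f i) * (\<Prod>j\<in>insert x I - {i}. f j)
        = f x * (fps_deriv (f i) * (\<Prod>j\<in>I - {i}. f j))"
      using insert.hyps by (simp add: ac_simps)
  qed simp
  moreover have "insert x I - {x} = I" using insert.hyps by auto
  ultimately show ?case
    using insert by (simp add: sum_distrib_left algebra_simps)
qed simp

text \<open>Differentiating the Leibniz formula by the product rule gives one determinant for each
  row i, in which that row alone is differentiated (\<open>C i\<close>). Laplace expansion along row
  i finishes, since the cofactors of row i do not see that row.\<close>

lemma fps_deriv_det:
  fixes B :: "'a::comm_ring_1 fps mat"
  assumes B: "B \<in> carrier_mat n n"
  shows "fps_deriv (det B) = (\<Sum>i<n. \<Sum>j<n. fps_deriv (B $$ (i,j)) * cofactor B i j)"
proof -
  define C where "C i = mat n n (\<lambda>(k,j). if k = i then fps_deriv (B $$ (i,j)) else B $$ (k,j))" for i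
  have C: "C i \<in> carrier_mat n n" for i by (simp add: C_def)
  let ?P = "{p. p permutes {0..<n}}"
  have sgn: "fps_deriv (signof p :: 'a fps) = 0" for p :: "nat \<Rightarrow> nat"
    by (simp add: sign_def)
  have summand: "fps_deriv (B $$ (i, p i)) * (\<Prod>l\<in>{0..<n} - {i}. B $$ (l, p l))
      = (\<Prod>l = 0..<n. C i $$ (l, p l))" if "p permutes {0..<n}" "i < n" for p i
  proof -
    have p: "p l < n" if "l < n" for l
      using permutes_in_image[OF \<open>p permutes _\<close>, of l] that by auto
    have "(\<Prod>l = 0..<n. C i $$ (l, p l)) = C i $$ (i, p i) * (\<Prod>l\<in>{0..<n} - {i}. C i $$ (l, p l))"
      using that by (intro prod.remove) auto
    also have "(\<Prod>l\<in>{0..<n} - {i}. C i $$ (l, p l)) = (\<Prod>l\<in>{0..<n} - {i}. B $$ (l, p l))"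
      using p by (intro prod.cong) (auto simp: C_def)
    finally show ?thesis using p that by (simp add: C_def)
  qed
  have "fps_deriv (det B) = (\<Sum>p\<in>?P. signof p * (\<Sum>i = 0..<n. \<Prod>l = 0..<n. C i $$ (l, p l)))"
    unfolding det_def'[OF B] fps_deriv_sum
    by (intro sum.cong refl) (simp add: sgn fps_deriv_prod summand)
  also have "\<dots> = (\<Sum>i = 0..<n. det (C i))"
    unfolding det_def'[OF C] by (simp add: sum_distrib_left sum.swap[of _ ?P])
  also have "\<dots> = (\<Sum>i<n. \<Sum>j<n. fps_deriv (B $$ (i,j)) * cofactor B i j)"
    unfolding atLeast0LessThan
  proof (intro sum.cong refl)
    fix i assume "i \<in> {..<n}"
    then have i: "i < n" by simp
    have "mat_delete (C i) i j = mat_delete B i j" for j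
      using B i by (auto simp: mat_delete_def C_def)
    then have "cofactor (C i) i j = cofactor B i j" for j by (simp add: cofactor_def)
    then show "det (C i) = (\<Sum>j<n. fps_deriv (B $$ (i,j)) * cofactor B i j)"
      unfolding laplace_expansion_row[OF C i] using i by (intro sum.cong) (auto simp: C_def)
  qed
  finally show ?thesis .
qed

section \<open>The reversed characteristic polynomial and Newton's identities\<close>

definition mat_trace :: "'a::comm_monoid_add mat \<Rightarrow> 'a" where
  "mat_trace A = (\<Sum>i<dim_row A. A $$ (i,i))"

text \<open>This is 1 - A X, whose determinant is the characteristic polynomial with reversed
  coefficients. Over power series it is inverted by the geometric series, whereas X - A need not be
  invertible.\<close>

definition rev_char_mat :: "'a::comm_ring_1 mat \<Rightarrow> 'a fps mat" where
  "rev_char_mat A = mat (dim_row A) (dim_row A)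
     (\<lambda>(i,j). fps_const (1\<^sub>m (dim_row A) $$ (i,j)) - fps_const (A $$ (i,j)) * fps_X)"

lemma det_rev_char_nth_0:
  fixes A :: "'a::comm_ring_1 mat"
  assumes A: "A \<in> carrier_mat m m"
  shows "fps_nth (det (rev_char_mat A)) 0 = 1"
proof -
  interpret comm_ring_hom "\<lambda>f::'a fps. fps_nth f 0" by unfold_locales simp_all
  have "map_mat (\<lambda>f. fps_nth f 0) (rev_char_mat A) = 1\<^sub>m m"
    using A by (intro eq_matI) (auto simp: rev_char_mat_def)
  then show ?thesis using hom_det[of "rev_char_mat A"] by simp
qed

text \<open>The second conjunct carries the induction: a new factor contributes \<open>a x\<close>
  times the coefficient just above the old degree, and this has to vanish for the top coefficient to
  be the product of the \<open>- b i\<close>.\<close>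

lemma fps_nth_prod_linear:
  fixes a b :: "'i \<Rightarrow> 'a::comm_ring_1"
  assumes "finite I"
  shows "fps_nth (\<Prod>i\<in>I. fps_const (a i) - fps_const (b i) * fps_X) (card I) = (-1) ^ card I * prod b I
    \<and> (\<forall>k>card I. fps_nth (\<Prod>i\<in>I. fps_const (a i) - fps_const (b i) * fps_X) k = 0)"
  using assms
proof induction
  case (insert x I)
  have "fps_nth ((fps_const (a x) - fps_const (b x) * fps_X) * f) (Suc k)
      = a x * fps_nth f (Suc k) - b x * fps_nth f k" for f k
    by (simp add: left_diff_distrib mult.assoc)
  then show ?case using insert
    by (auto simp: Suc_less_eq2)
qed simp

text \<open>In each Leibniz term the m linear factors reach X^m only through the X part of every
  factor, which leaves (-1)^m times the corresponding term of \<open>det A\<close>.\<close>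

lemma det_rev_char_nth_dim:
  fixes A :: "'a::comm_ring_1 mat"
  assumes A: "A \<in> carrier_mat m m"
  shows "fps_nth (det (rev_char_mat A)) m = (-1) ^ m * det A"
proof -
  have R: "rev_char_mat A \<in> carrier_mat m m" using A by (simp add: rev_char_mat_def)
  have sgn: "fps_nth (signof p * f) k = signof p * fps_nth f k" for p :: "nat \<Rightarrow> nat" and f :: "'a fps" and k
    by (simp add: sign_def)
  show ?thesis
    unfolding det_def'[OF A] det_def'[OF R] fps_sum_nth sgn sum_distrib_left
  proof (intro sum.cong refl)
    fix p assume "p \<in> {p. p permutes {0..<m}}"
    then have p: "p l < m" if "l < m" for l
      using permutes_in_image[of p "{0..<m}" l] that by auto
    have "(\<Prod>i = 0..<m. rev_char_mat A $$ (i, p i)) =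
      (\<Prod>i = 0..<m. fps_const (1\<^sub>m m $$ (i,p i)) - fps_const (A $$ (i,p i)) * fps_X)"
      using A p by (intro prod.cong) (auto simp: rev_char_mat_def)
    then show "signof p * fps_nth (\<Prod>i = 0..<m. rev_char_mat A $$ (i, p i)) m
        = (- 1) ^ m * (signof p * (\<Prod>i = 0..<m. A $$ (i, p i)))"
      using fps_nth_prod_linear[of "{0..<m}" "\<lambda>i. 1\<^sub>m m $$ (i,p i)" "\<lambda>i. A $$ (i,p i)"]
      by (simp add: algebra_simps)
  qed
qed

text \<open>
  Jacobi's formula for B = 1 - A X, where adj B = det B (\<Sum>k. A^k X^k).
\<close>

lemma newton_identity_det:
  fixes A :: "'a::comm_ring_1 mat"
  assumes A: "A \<in> carrier_mat m m"
  shows "of_nat (Suc k) * fps_nth (det (rev_char_mat A)) (Suc k)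
    = - (\<Sum>j\<le>k. fps_nth (det (rev_char_mat A)) j * mat_trace (A ^\<^sub>m Suc (k - j)))"
proof -
  let ?B = "rev_char_mat A" and ?D = "det (rev_char_mat A)"
  define S where "S = mat m m (\<lambda>(i,j). Abs_fps (\<lambda>k. (A ^\<^sub>m k) $$ (i,j)))"
  have B: "?B \<in> carrier_mat m m" using A by (simp add: rev_char_mat_def)
  have S: "S \<in> carrier_mat m m" by (simp add: S_def)
  have Ak: "A ^\<^sub>m k \<in> carrier_mat m m" for k using A by simp
  \<comment> \<open>\<open>S\<close> is the geometric series of A X: coefficient k of
    \<open>S * ?B\<close> is A^k - A^(k-1) A = 0 for k > 0, and the identity for k = 0.\<close>
  have SB: "S * ?B = 1\<^sub>m m"
  proof (rule eq_matI)
    fix i j assume "i < dim_row (1\<^sub>m m :: 'a fps mat)" "j < dim_col (1\<^sub>m m :: 'a fps mat)"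
    then have ij: "i < m" "j < m" by auto
    have "fps_nth ((S * ?B) $$ (i,j)) k = fps_nth (1\<^sub>m m $$ (i,j)) k" for k
    proof -
      have "(S * ?B) $$ (i,j) = (\<Sum>l = 0..<m. S $$ (i,l) * ?B $$ (l,j))"
        using S B ij by (simp add: scalar_prod_def)
      also have "\<dots> = (\<Sum>l = 0..<m. S $$ (i,l) * fps_const (1\<^sub>m m $$ (l,j)))
          - (\<Sum>l = 0..<m. S $$ (i,l) * fps_const (A $$ (l,j))) * fps_X"
        unfolding sum_distrib_right sum_subtractf[symmetric] using A ij
        by (intro sum.cong) (auto simp: rev_char_mat_def algebra_simps)
      also have "(\<Sum>l = 0..<m. S $$ (i,l) * fps_const (1\<^sub>m m $$ (l,j))) = S $$ (i,j)"
      proof -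
        have "(\<Sum>l = 0..<m. S $$ (i,l) * fps_const (1\<^sub>m m $$ (l,j)))
            = (\<Sum>l = 0..<m. if l = j then S $$ (i,l) else 0)"
          using ij by (intro sum.cong) auto
        then show ?thesis using ij by simp
      qed
      finally have eq: "(S * ?B) $$ (i,j) = S $$ (i,j) - (\<Sum>l = 0..<m. S $$ (i,l) * fps_const (A $$ (l,j))) * fps_X" .
      show ?thesis
      proof (cases k)
        case 0
        then show ?thesis unfolding eq using A ij by (simp add: S_def)
      next
        case (Suc k')
        have "(A ^\<^sub>m Suc k') $$ (i,j) = (\<Sum>l = 0..<m. (A ^\<^sub>m k') $$ (i,l) * A $$ (l,j))"
          using A Ak[of k'] ij by (simp add: scalar_prod_def)
        also have "\<dots> = fps_nth (\<Sum>l = 0..<m. S $$ (i,l) * fps_const (A $$ (l,j))) k'"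
          unfolding fps_sum_nth using ij by (intro sum.cong) (auto simp: S_def)
        finally show ?thesis unfolding eq using Suc ij by (simp add: S_def)
      qed
    qed
    then show "(S * ?B) $$ (i,j) = 1\<^sub>m m $$ (i,j)" by (simp add: fps_eq_iff)
  qed (use S B in auto)
  \<comment> \<open>The left inverse \<open>S\<close> extracts the adjugate from B adj B = det B
    without any assumption that A is invertible.\<close>
  have adj: "adj_mat ?B = ?D \<cdot>\<^sub>m S"
  proof -
    have "adj_mat ?B = (S * ?B) * adj_mat ?B" unfolding SB using adj_mat(1)[OF B] by simp
    also have "\<dots> = S * (?B * adj_mat ?B)" using S B adj_mat(1)[OF B] by (rule assoc_mult_mat)
    also have "\<dots> = ?D \<cdot>\<^sub>m S" unfolding adj_mat(2)[OF B] using S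
      by (metis mult_smult_distrib one_carrier_mat right_mult_one_mat)
    finally show ?thesis .
  qed
  have cof: "cofactor ?B i j = ?D * S $$ (j,i)" if "i < m" "j < m" for i j
  proof -
    have "cofactor ?B i j = adj_mat ?B $$ (j,i)" using that B by (simp add: adj_mat_def)
    then show ?thesis unfolding adj using that S by simp
  qed
  \<comment> \<open>\<open>T\<close> generates the power sums trace(A^(k+1)). Jacobi's formula
    becomes D' = - D T, and comparing coefficients gives Newton's identity.\<close>
  define T where "T = Abs_fps (\<lambda>k. mat_trace (A ^\<^sub>m Suc k))"
  have T: "(\<Sum>i<m. \<Sum>j<m. fps_const (A $$ (i,j)) * S $$ (j,i)) = T"
  proof (rule fps_ext)
    fix k
    have "mat_trace (A ^\<^sub>m Suc k) = (\<Sum>j<m. \<Sum>i<m. (A ^\<^sub>m k) $$ (j,i) * A $$ (i,j))"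
      unfolding mat_trace_def using A Ak[of k]
      by (auto simp: scalar_prod_def atLeast0LessThan intro!: sum.cong)
    also have "\<dots> = (\<Sum>i<m. \<Sum>j<m. A $$ (i,j) * (A ^\<^sub>m k) $$ (j,i))"
      by (subst sum.swap) (simp add: mult.commute)
    finally show "fps_nth (\<Sum>i<m. \<Sum>j<m. fps_const (A $$ (i,j)) * S $$ (j,i)) k = fps_nth T k"
      by (simp add: fps_sum_nth T_def S_def)
  qed
  have "fps_deriv ?D = (\<Sum>i<m. \<Sum>j<m. - (fps_const (A $$ (i,j)) * (?D * S $$ (j,i))))"
    unfolding fps_deriv_det[OF B]
  proof (intro sum.cong refl)
    fix i j assume "i \<in> {..<m}" "j \<in> {..<m}"
    then have ij: "i < m" "j < m" by auto
    have "fps_deriv (?B $$ (i,j)) = - fps_const (A $$ (i,j))"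
      using A ij by (simp add: rev_char_mat_def)
    then show "fps_deriv (?B $$ (i,j)) * cofactor ?B i j = - (fps_const (A $$ (i,j)) * (?D * S $$ (j,i)))"
      unfolding cof[OF ij] by (simp del: fps_const_neg)
  qed
  also have "\<dots> = - (?D * T)"
    unfolding T[symmetric] sum_distrib_left sum_negf[symmetric] by (simp add: ac_simps del: fps_const_neg)
  finally have "fps_nth (fps_deriv ?D) k = - fps_nth (?D * T) k" by simp
  then show ?thesis by (simp add: fps_mult_nth T_def atLeast0AtMost)
qed

text \<open>
  The coefficient vector c of det (1 - A X) satisfies c = e + L c with e the first unit vector and
  L = csanky_mat A strictly lower triangular, so that c = (\<Sum>i. L^i e).
\<close>

definition csanky_mat :: "'a::field_char_0 mat \<Rightarrow> 'a mat" where
  "csanky_mat A = mat (Suc (dim_row A)) (Suc (dim_row A))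
     (\<lambda>(k,j). if j < k then - mat_trace (A ^\<^sub>m (k - j)) / of_nat k else 0)"

lemma det_csanky:
  fixes A :: "'a::field_char_0 mat"
  assumes A: "A \<in> carrier_mat m m"
  shows "det A = (-1) ^ m * (\<Sum>i\<le>m. (csanky_mat A ^\<^sub>m i) $$ (m,0))"
proof -
  let ?L = "csanky_mat A"
  define c where "c = fps_nth (det (rev_char_mat A))"
  have L: "?L \<in> carrier_mat (Suc m) (Suc m)" using A by (simp add: csanky_mat_def)
  have Lk: "?L ^\<^sub>m k \<in> carrier_mat (Suc m) (Suc m)" for k using L by simp
  have L_Suc: "(?L ^\<^sub>m Suc i) $$ (k,j) = (\<Sum>l\<le>m. (?L ^\<^sub>m i) $$ (k,l) * ?L $$ (l,j))"
    if "k \<le> m" "j \<le> m" for i k j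
    using L Lk[of i] that
    by (auto simp: scalar_prod_def atLeast0LessThan lessThan_Suc_atMost intro!: sum.cong)
  have c_rec: "c k = (if k = 0 then 1 else 0) + (\<Sum>j\<le>m. ?L $$ (k,j) * c j)" if "k \<le> m" for k
  proof (cases k)
    case 0
    have "(\<Sum>j\<le>m. ?L $$ (0,j) * c j) = 0"
      using A by (intro sum.neutral) (auto simp: csanky_mat_def)
    then show ?thesis using 0 det_rev_char_nth_0[OF A] by (simp add: c_def)
  next
    case (Suc k')
    have "(\<Sum>j\<le>m. ?L $$ (k,j) * c j) = (\<Sum>j\<le>k'. ?L $$ (k,j) * c j)"
      using A that Suc by (intro sum.mono_neutral_right) (auto simp: csanky_mat_def)
    also have "\<dots> = (\<Sum>j\<le>k'. - (c j * mat_trace (A ^\<^sub>m Suc (k' - j))) / of_nat k)"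
      using A that Suc by (intro sum.cong) (auto simp: csanky_mat_def Suc_diff_le)
    also have "\<dots> = c k"
    proof -
      have "of_nat k * c k = - (\<Sum>j\<le>k'. c j * mat_trace (A ^\<^sub>m Suc (k' - j)))"
        using newton_identity_det[OF A, of k'] Suc by (simp only: c_def)
      moreover have "of_nat k \<noteq> (0 :: 'a)" using Suc by (simp del: of_nat_Suc)
      ultimately have "c k = - (\<Sum>j\<le>k'. c j * mat_trace (A ^\<^sub>m Suc (k' - j))) / of_nat k"
        by (metis nonzero_mult_div_cancel_left)
      then show ?thesis by (simp only: sum_divide_distrib sum_negf[symmetric])
    qed
    finally show ?thesis using Suc by simp
  qed
  \<comment> \<open>Every factor L raises the index by at least one from column to row, so a nonzero
    entry (k,j) of L^i needs k >= i + j.\<close>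
  have nilp: "(?L ^\<^sub>m i) $$ (k,j) = 0" if "k \<le> m" "j \<le> m" "k < i + j" for i k j
    using that
  proof (induction i arbitrary: j)
    case 0
    then show ?case using L by auto
  next
    case (Suc i)
    have "(?L ^\<^sub>m i) $$ (k,l) * ?L $$ (l,j) = 0" if "l \<le> m" for l
    proof (cases "j < l")
      case True
      then show ?thesis using Suc that by auto
    next
      case False
      then show ?thesis using A that Suc by (simp add: csanky_mat_def)
    qed
    then show ?case unfolding L_Suc[OF Suc.prems(1,2)] by (intro sum.neutral) auto
  qed
  \<comment> \<open>The recursion c = e + L c is unrolled K times; the remainder L^K c disappears
    for K = m + 1 by \<open>nilp\<close>.\<close>
  have "c m = (\<Sum>i<K. (?L ^\<^sub>m i) $$ (m,0)) + (\<Sum>j\<le>m. (?L ^\<^sub>m K) $$ (m,j) * c j)" for K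
  proof (induction K)
    case 0
    have "(\<Sum>j\<le>m. (?L ^\<^sub>m 0) $$ (m,j) * c j) = (\<Sum>j\<le>m. if j = m then c j else 0)"
      using L by (intro sum.cong) auto
    then show ?case by simp
  next
    case (Suc K)
    have "(\<Sum>j\<le>m. (?L ^\<^sub>m K) $$ (m,j) * c j)
        = (\<Sum>j\<le>m. (if j = 0 then (?L ^\<^sub>m K) $$ (m,j) else 0)
            + (\<Sum>l\<le>m. (?L ^\<^sub>m K) $$ (m,j) * ?L $$ (j,l) * c l))"
      by (rule sum.cong, simp, subst c_rec, simp) (simp add: distrib_left sum_distrib_left ac_simps)
    also have "\<dots> = (?L ^\<^sub>m K) $$ (m,0)
        + (\<Sum>j\<le>m. \<Sum>l\<le>m. (?L ^\<^sub>m K) $$ (m,j) * ?L $$ (j,l) * c l)"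
      by (simp add: sum.distrib)
    also have "(\<Sum>j\<le>m. \<Sum>l\<le>m. (?L ^\<^sub>m K) $$ (m,j) * ?L $$ (j,l) * c l)
        = (\<Sum>j\<le>m. (?L ^\<^sub>m Suc K) $$ (m,j) * c j)"
      by (subst sum.swap, rule sum.cong) (simp_all add: L_Suc sum_distrib_right del: pow_mat.simps)
    finally show ?case using Suc.IH by (simp del: pow_mat.simps)
  qed
  from this[of "Suc m"] have "c m = (\<Sum>i\<le>m. (?L ^\<^sub>m i) $$ (m,0))"
    by (simp add: nilp lessThan_Suc_atMost del: pow_mat.simps)
  moreover have "c m = (-1) ^ m * det A" unfolding c_def by (rule det_rev_char_nth_dim[OF A])
  ultimately show ?thesis by (metis (no_types) left_minus_one_mult_self)
qed

section \<open>Straight-line programs\<close>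

definition gate_values :: "real list \<Rightarrow> gate list \<Rightarrow> real list" where
  "gate_values xs G = foldl (\<lambda>vs g. vs @ [gate_value xs vs g]) [] G"

definition gate_depths :: "gate list \<Rightarrow> nat list" where
  "gate_depths G = foldl (\<lambda>vs g. vs @ [gate_depth vs g]) [] G"

lemma gate_values_simps [simp]:
  "gate_values xs [] = []"
  "gate_values xs (G @ [g]) = gate_values xs G @ [gate_value xs (gate_values xs G) g]"
  by (simp_all add: gate_values_def)

lemma gate_depths_simps [simp]:
  "gate_depths [] = []"
  "gate_depths (G @ [g]) = gate_depths G @ [gate_depth (gate_depths G) g]"
  by (simp_all add: gate_depths_def)

lemma length_gate_values [simp]: "length (gate_values xs G) = length G"
  by (induction G rule: rev_induct) simp_all

lemma length_gate_depths [simp]: "length (gate_depths G) = length G"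
  by (induction G rule: rev_induct) simp_all

lemma gate_values_append: "\<exists>vs. gate_values xs (G @ H) = gate_values xs G @ vs"
proof (induction H rule: rev_induct)
  case (snoc g H)
  then show ?case using gate_values_simps(2)[of xs "G @ H" g] by auto
qed simp

lemma gate_depths_append: "\<exists>vs. gate_depths (G @ H) = gate_depths G @ vs"
proof (induction H rule: rev_induct)
  case (snoc g H)
  then show ?case using gate_depths_simps(2)[of "G @ H" g] by auto
qed simp

lemma nth_gate_values_append [simp]:
  "k < length G \<Longrightarrow> gate_values xs (G @ H) ! k = gate_values xs G ! k"
  using gate_values_append[of xs G H] by (auto simp: nth_append)

lemma nth_gate_depths_append [simp]:
  "k < length G \<Longrightarrow> gate_depths (G @ H) ! k = gate_depths G ! k"
  using gate_depths_append[of G H] by (auto simp: nth_append)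

definition wf_gates :: "nat \<Rightarrow> gate list \<Rightarrow> bool" where
  "wf_gates N G \<longleftrightarrow> (\<forall>k<length G. wf_gate N k (G ! k))"

lemma wf_gates_simps [simp]:
  "wf_gates N []"
  "wf_gates N (G @ [g]) \<longleftrightarrow> wf_gates N G \<and> wf_gate N (length G) g"
  by (auto simp: wf_gates_def nth_append less_Suc_eq)

definition computes :: "nat \<Rightarrow> gate list \<Rightarrow> (real list \<Rightarrow> real) \<Rightarrow> nat \<Rightarrow> bool" where
  "computes N G f k \<longleftrightarrow> k < length G \<and> (\<forall>xs. length xs = N \<longrightarrow> gate_values xs G ! k = f xs)"

lemma computes_append: "computes N G f k \<Longrightarrow> computes N (G @ H) f k"
  by (simp add: computes_def)

text \<open>Gate positions are hidden: a program is known only through bounds on its size and depth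
  and a set of functions found among its gates. Building a circuit in stages then means enlarging
  that set.\<close>

definition slp :: "nat \<Rightarrow> nat \<Rightarrow> nat \<Rightarrow> (real list \<Rightarrow> real) set \<Rightarrow> bool" where
  "slp N s d F \<longleftrightarrow> (\<exists>G. wf_gates N G \<and> length G \<le> s \<and> (\<forall>k<length G. gate_depths G ! k \<le> d) \<and>
     (\<forall>f\<in>F. \<exists>k. computes N G f k))"

lemma slp_mono:
  assumes "slp N s d F" "s \<le> s'" "d \<le> d'" "F' \<subseteq> F"
  shows "slp N s' d' F'"
  using assms unfolding slp_def by (meson order_trans subsetD)

lemma slp_inputs_consts:
  assumes "finite C"
  shows "slp N (N + card C) 0 ((\<lambda>i xs. xs ! i) ` {..<N} \<union> (\<lambda>c xs. c) ` C)"
proof -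
  have inputs: "\<exists>G. wf_gates N G \<and> length G = M \<and> (\<forall>k<length G. gate_depths G ! k = 0) \<and>
      (\<forall>i<M. computes N G (\<lambda>xs. xs ! i) i)" if "M \<le> N" for M
    using that
  proof (induction M)
    case (Suc M)
    then obtain G where "wf_gates N G" "length G = M" "\<forall>k<length G. gate_depths G ! k = 0"
      "\<forall>i<M. computes N G (\<lambda>xs. xs ! i) i" by auto
    then show ?case using Suc.prems
      by (intro exI[of _ "G @ [InputG M]"]) (auto simp: computes_def nth_append less_Suc_eq)
  qed auto
  have "\<exists>G. wf_gates N G \<and> length G = N + card C \<and> (\<forall>k<length G. gate_depths G ! k = 0) \<and>
      (\<forall>i<N. computes N G (\<lambda>xs. xs ! i) i) \<and> (\<forall>c\<in>C. \<exists>k. computes N G (\<lambda>xs. c) k)"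
    using assms
  proof (induction C)
    case empty
    then show ?case using inputs[of N] by simp
  next
    case (insert c C)
    then obtain G where G: "wf_gates N G" "length G = N + card C" "\<forall>k<length G. gate_depths G ! k = 0"
      "\<forall>i<N. computes N G (\<lambda>xs. xs ! i) i" "\<forall>c\<in>C. \<exists>k. computes N G (\<lambda>xs. c) k" by blast
    have "computes N (G @ [ConstG c]) (\<lambda>xs. c) (length G)"
      by (simp add: computes_def nth_append)
    then show ?case using G insert.hyps computes_append
      by (intro exI[of _ "G @ [ConstG c]"]) (fastforce simp: less_Suc_eq nth_append)
  qed
  then show ?thesis unfolding slp_def
    by (elim exE) (rule exI, auto)
qed

text \<open>Signs and divisions by integers enter as multiplication by available constants such as
  (-1)^m or -1/k.\<close>

inductive one_gate :: "(real list \<Rightarrow> real) set \<Rightarrow> (real list \<Rightarrow> real) \<Rightarrow> bool" for F where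
  add: "f \<in> F \<Longrightarrow> g \<in> F \<Longrightarrow> one_gate F (\<lambda>xs. f xs + g xs)"
| mult: "f \<in> F \<Longrightarrow> g \<in> F \<Longrightarrow> one_gate F (\<lambda>xs. f xs * g xs)"

text \<open>Each new gate reads its operands in \<open>G\<close>, where the depth is at most d, and
  never in the part \<open>H\<close> that already holds other functions of \<open>T\<close>. Hence
  the depth grows by one whatever the size of \<open>T\<close>.\<close>

lemma slp_layer:
  assumes F: "slp N s d F" and "finite T" and T: "\<And>h. h \<in> T \<Longrightarrow> one_gate F h"
  shows "slp N (s + card T) (Suc d) (F \<union> T)"
proof -
  obtain G where G: "wf_gates N G" "length G \<le> s" "\<forall>k<length G. gate_depths G ! k \<le> d"
    "\<forall>f\<in>F. \<exists>k. computes N G f k" using F unfolding slp_def by blast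
  have "\<exists>H. wf_gates N (G @ H) \<and> length H = card T \<and>
      (\<forall>k<length (G @ H). gate_depths (G @ H) ! k \<le> Suc d) \<and> (\<forall>f\<in>T. \<exists>k. computes N (G @ H) f k)"
    using \<open>finite T\<close> T
  proof (induction T)
    case empty
    then show ?case using G by (intro exI[of _ "[]"]) (auto simp: le_SucI)
  next
    case (insert h T)
    then obtain H where H: "wf_gates N (G @ H)" "length H = card T"
      "\<forall>k<length (G @ H). gate_depths (G @ H) ! k \<le> Suc d" "\<forall>f\<in>T. \<exists>k. computes N (G @ H) f k"
      by blast
    have "\<exists>e. wf_gate N (length (G @ H)) e \<and> gate_depth (gate_depths (G @ H)) e \<le> Suc d \<and>
        (\<forall>xs. length xs = N \<longrightarrow> gate_value xs (gate_values xs (G @ H)) e = h xs)"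
      using insert.prems[of h, simplified]
    proof cases
      case (add f g)
      then obtain p q where "computes N G f p" "computes N G g q" using G(4) by blast
      then show ?thesis using G(3) add
        by (intro exI[of _ "AddG p q"]) (auto simp: computes_def)
    next
      case (mult f g)
      then obtain p q where "computes N G f p" "computes N G g q" using G(4) by blast
      then show ?thesis using G(3) mult
        by (intro exI[of _ "MulG p q"]) (auto simp: computes_def)
    qed
    then obtain e where e: "wf_gate N (length (G @ H)) e" "gate_depth (gate_depths (G @ H)) e \<le> Suc d"
      "\<And>xs. length xs = N \<Longrightarrow> gate_value xs (gate_values xs (G @ H)) e = h xs" by blast
    have snoc: "G @ H @ [e] = (G @ H) @ [e]" by simp
    have "computes N (G @ H @ [e]) h (length (G @ H))"
      using e(3) unfolding snoc by (simp add: computes_def nth_append del: append_assoc)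
    moreover have "\<exists>k. computes N (G @ H @ [e]) f k" if "f \<in> T" for f
      using H(4) that computes_append unfolding snoc by blast
    moreover have "gate_depths (G @ H @ [e]) ! k \<le> Suc d" if "k < length (G @ H @ [e])" for k
      using that H(3) e(2) unfolding snoc
      by (auto simp: nth_append less_Suc_eq simp del: append_assoc)
    moreover have "wf_gates N (G @ H @ [e])"
      using H(1) e(1) unfolding snoc by (simp del: append_assoc)
    ultimately show ?case using H(2) insert.hyps by (intro exI[of _ "H @ [e]"]) auto
  qed
  then obtain H where "wf_gates N (G @ H)" "length H = card T"
    "\<forall>k<length (G @ H). gate_depths (G @ H) ! k \<le> Suc d" "\<forall>f\<in>T. \<exists>k. computes N (G @ H) f k" by blast
  moreover have "\<forall>f\<in>F. \<exists>k. computes N (G @ H) f k" using G(4) computes_append by blast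
  ultimately show ?thesis unfolding slp_def using G(2)
    by (intro exI[of _ "G @ H"]) auto
qed

lemma slp_image:
  assumes "slp N s d F" "finite I" "\<And>i. i \<in> I \<Longrightarrow> one_gate F (h i)"
  shows "slp N (s + card I) (Suc d) (F \<union> h ` I)"
proof (rule slp_mono)
  show "slp N (s + card (h ` I)) (Suc d) (F \<union> h ` I)"
    using assms by (intro slp_layer) auto
qed (use assms card_image_le[of I h] in auto)

text \<open>A balanced binary tree: the neighbours 2l and 2l + 1 are added in one layer, which
  leaves half as many summands. The trees for all i in \<open>I\<close> grow in parallel, so
  \<open>card I\<close> affects the size but not the depth.\<close>

lemma slp_sum_pow2:
  fixes h :: "'i \<Rightarrow> nat \<Rightarrow> real list \<Rightarrow> real"
  assumes "slp N s d F" "finite I" "\<And>i l. i \<in> I \<Longrightarrow> l < 2 ^ t \<Longrightarrow> h i l \<in> F"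
  shows "slp N (s + card I * 2 ^ t) (d + t) (F \<union> (\<lambda>i xs. \<Sum>l<2 ^ t. h i l xs) ` I)"
  using assms
proof (induction t arbitrary: s d F h)
  case 0
  have eq: "(\<lambda>i xs. \<Sum>l<2 ^ 0. h i l xs) = (\<lambda>i. h i 0)" by (simp add: fun_eq_iff)
  have "(\<lambda>i xs. \<Sum>l<2 ^ 0. h i l xs) ` I \<subseteq> F" unfolding eq using 0 by auto
  then show ?case using 0 by (auto simp: Un_absorb2 intro: slp_mono)
next
  case (Suc t)
  define h' where "h' i l = (\<lambda>xs. h i (2 * l) xs + h i (2 * l + 1) xs)" for i and l :: nat
  define F' where "F' = F \<union> (\<lambda>(i,l). h' i l) ` (I \<times> {..<2 ^ t})"
  have "slp N (s + card (I \<times> {..<2 ^ t :: nat})) (Suc d) F'"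
    unfolding F'_def using Suc.prems
    by (intro slp_image) (auto simp: h'_def intro!: one_gate.add)
  then have "slp N (s + card I * 2 ^ t) (Suc d) F'" using Suc.prems by (simp add: card_cartesian_product)
  then have sum: "slp N (s + card I * 2 ^ t + card I * 2 ^ t) (Suc d + t) (F' \<union> (\<lambda>i xs. \<Sum>l<2 ^ t. h' i l xs) ` I)"
    using Suc.prems by (intro Suc.IH) (auto simp: F'_def)
  have "(\<Sum>l<M. h' i l xs) = (\<Sum>l<2 * M. h i l xs)" for i xs M
    by (induction M) (simp_all add: h'_def algebra_simps)
  then have "(\<lambda>i xs. \<Sum>l<2 ^ t. h' i l xs) = (\<lambda>i xs. \<Sum>l<2 ^ Suc t. h i l xs)"
    by simp
  then have "F \<union> (\<lambda>i xs. \<Sum>l<2 ^ Suc t. h i l xs) ` I \<subseteq> F' \<union> (\<lambda>i xs. \<Sum>l<2 ^ t. h' i l xs) ` I"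
    by (auto simp only: F'_def)
  then show ?case using sum by (elim slp_mono) (simp_all add: algebra_simps)
qed

text \<open>The sum is padded with the zero function up to a power of two, which is why zero must be
  available.\<close>

lemma slp_sum:
  fixes m :: nat
  assumes "slp N s d F" "finite I" "(\<lambda>xs. 0) \<in> F" "m \<le> 2 ^ t"
    "\<And>i l. i \<in> I \<Longrightarrow> l < m \<Longrightarrow> h i l \<in> F"
  shows "slp N (s + card I * 2 ^ t) (d + t) (F \<union> (\<lambda>i xs. \<Sum>l<m. h i l xs) ` I)"
proof -
  define h' where "h' i l = (if l < m then h i l else (\<lambda>xs. 0))" for i l
  have "slp N (s + card I * 2 ^ t) (d + t) (F \<union> (\<lambda>i xs. \<Sum>l<2 ^ t. h' i l xs) ` I)"
    using assms by (intro slp_sum_pow2) (auto simp: h'_def)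
  moreover have "(\<Sum>l<2 ^ t. h' i l xs) = (\<Sum>l<m. h i l xs)" for i xs
    using assms(4) by (intro sum.mono_neutral_cong_right) (auto simp: h'_def)
  ultimately show ?thesis by simp
qed

text \<open>The two halves of \<open>2 * 2 ^ t\<close> pay for the layer of products and for the
  summation tree.\<close>

lemma slp_dot:
  fixes m :: nat
  assumes F: "slp N s d F" and I: "finite I" and "(\<lambda>xs. 0) \<in> F" "m \<le> 2 ^ t"
    "\<And>i l. i \<in> I \<Longrightarrow> l < m \<Longrightarrow> u i l \<in> F" "\<And>i l. i \<in> I \<Longrightarrow> l < m \<Longrightarrow> v i l \<in> F"
  shows "slp N (s + card I * (2 * 2 ^ t)) (Suc d + t) (F \<union> (\<lambda>i xs. \<Sum>l<m. u i l xs * v i l xs) ` I)"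
proof -
  define w where "w i l = (\<lambda>xs. u i l xs * v i l xs)" for i l
  define F' where "F' = F \<union> (\<lambda>(i,l). w i l) ` (I \<times> {..<m})"
  have "slp N (s + card (I \<times> {..<m})) (Suc d) F'"
    unfolding F'_def using assms by (intro slp_image) (auto simp: w_def intro!: one_gate.mult)
  moreover have "card (I \<times> {..<m}) \<le> card I * 2 ^ t"
    using assms(4) by (simp add: card_cartesian_product)
  ultimately have "slp N (s + card I * 2 ^ t) (Suc d) F'" by (auto intro: slp_mono)
  then have "slp N (s + card I * 2 ^ t + card I * 2 ^ t) (Suc d + t) (F' \<union> (\<lambda>i xs. \<Sum>l<m. w i l xs) ` I)"
    using assms by (intro slp_sum) (auto simp: F'_def)
  then show ?thesis by (auto simp: F'_def w_def algebra_simps intro: slp_mono)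
qed

section \<open>Matrix powers and determinants in parallel\<close>

lemma pow_mat_add:
  assumes "A \<in> carrier_mat n n"
  shows "A ^\<^sub>m (k + l) = A ^\<^sub>m k * A ^\<^sub>m l"
proof (induction l)
  case 0
  then show ?case using assms right_mult_one_mat[OF pow_carrier_mat[OF assms, of k]] by simp
next
  case (Suc l)
  then show ?case
    using assoc_mult_mat[OF pow_carrier_mat[OF assms, of k] pow_carrier_mat[OF assms, of l] assms] by simp
qed

definition mat_entries :: "'j set \<Rightarrow> nat set \<Rightarrow> nat \<Rightarrow> ('j \<Rightarrow> real list \<Rightarrow> real mat) \<Rightarrow> (real list \<Rightarrow> real) set" where
  "mat_entries J K m M = (\<lambda>(p,k,i,j) xs. (M p xs ^\<^sub>m k) $$ (i,j)) ` (J \<times> K \<times> {..<m} \<times> {..<m})"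

text \<open>All powers up to 2^r are produced, not just repeated squares, since the power sums and
  the series of the L^i need every exponent. Each round doubles the reach and costs one layer of
  products and a summation tree, so depth t + 1.\<close>

lemma slp_mat_pow:
  fixes M :: "'j \<Rightarrow> real list \<Rightarrow> real mat"
  assumes F: "slp N s d F" and J: "finite J" and const: "(\<lambda>xs. 0) \<in> F" "(\<lambda>xs. 1) \<in> F"
    and m: "m \<le> 2 ^ t"
    and M: "\<And>p xs. p \<in> J \<Longrightarrow> M p xs \<in> carrier_mat m m"
    and entries: "\<And>p i j. p \<in> J \<Longrightarrow> i < m \<Longrightarrow> j < m \<Longrightarrow> (\<lambda>xs. M p xs $$ (i,j)) \<in> F"
  shows "slp N (s + r * (card J * Suc (2 ^ r) * m\<^sup>2 * (2 * 2 ^ t))) (d + r * Suc t)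
           (F \<union> mat_entries J {..2 ^ r} m M)"
proof -
  \<comment> \<open>Every round is charged the size of the last and largest one, which makes the
    bound linear in the number of rounds.\<close>
  have "slp N (s + r' * (card J * Suc (2 ^ r) * m\<^sup>2 * (2 * 2 ^ t))) (d + r' * Suc t)
           (F \<union> mat_entries J {..2 ^ r'} m M)" if "r' \<le> r" for r'
    using that
  proof (induction r')
    case 0
    \<comment> \<open>Before the first round, the powers 0 and 1 consist of the constants 0 and 1
      and of the given entries.\<close>
    have entry: "(M p xs ^\<^sub>m k) $$ (i,j) = (if k = 0 then if i = j then 1 else 0 else M p xs $$ (i,j))"
      if "k \<le> 1" "p \<in> J" "i < m" "j < m" for p k i j xs
    proof (cases "k = 0")
      case False
      then have "k = Suc 0" using that by simp
      then show ?thesis using M[OF that(2), of xs] by simp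
    qed (use that M[OF that(2), of xs] in auto)
    have "mat_entries J {..2 ^ 0} m M \<subseteq> F"
    proof (clarsimp simp: mat_entries_def)
      fix p k i j assume *: "p \<in> J" "k \<le> Suc 0" "i < m" "j < m"
      then have "(\<lambda>xs. (M p xs ^\<^sub>m k) $$ (i,j))
          = (if k = 0 then if i = j then (\<lambda>xs. 1) else (\<lambda>xs. 0) else (\<lambda>xs. M p xs $$ (i,j)))"
        using entry by auto
      then show "(\<lambda>xs. (M p xs ^\<^sub>m k) $$ (i,j)) \<in> F" using const entries * by simp
    qed
    then show ?case using F by (simp add: Un_absorb2)
  next
    case (Suc r')
    let ?I = "J \<times> {..2 ^ Suc r' :: nat} \<times> {..<m} \<times> {..<m}"
    let ?F = "F \<union> mat_entries J {..2 ^ r'} m M"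
    \<comment> \<open>For k <= 2^(r' + 1) both \<open>k div 2\<close> and \<open>k - k div 2\<close>
      are at most 2^r', so each new power is one product of old ones.\<close>
    define u where "u x l = (case x of (p,k,i,j) \<Rightarrow> \<lambda>xs. (M p xs ^\<^sub>m (k div 2)) $$ (i,l))"
      for x :: "'j \<times> nat \<times> nat \<times> nat" and l
    define v where "v x l = (case x of (p,k,i,j) \<Rightarrow> \<lambda>xs. (M p xs ^\<^sub>m (k - k div 2)) $$ (l,j))"
      for x :: "'j \<times> nat \<times> nat \<times> nat" and l
    have mem: "(\<lambda>xs. (M p xs ^\<^sub>m k) $$ (i,j)) \<in> mat_entries J {..2 ^ r'} m M"
      if "p \<in> J" "k \<le> 2 ^ r'" "i < m" "j < m" for p k i j
      using that unfolding mat_entries_def by (intro image_eqI[of _ _ "(p,k,i,j)"]) auto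
    have "slp N (s + r' * (card J * Suc (2 ^ r) * m\<^sup>2 * (2 * 2 ^ t)) + card ?I * (2 * 2 ^ t))
        (Suc (d + r' * Suc t) + t) (?F \<union> (\<lambda>x xs. \<Sum>l<m. u x l xs * v x l xs) ` ?I)"
      using Suc J const m
      by (intro slp_dot) (auto simp: u_def v_def intro!: mem)
    moreover have "(\<Sum>l<m. u x l xs * v x l xs) = (case x of (p,k,i,j) \<Rightarrow> (M p xs ^\<^sub>m k) $$ (i,j))"
      if "x \<in> ?I" for x xs
    proof -
      obtain p k i j where x: "x = (p,k,i,j)" "p \<in> J" "i < m" "j < m"
        using \<open>x \<in> ?I\<close> by (cases x) auto
      have "M p xs ^\<^sub>m k = M p xs ^\<^sub>m (k div 2) * M p xs ^\<^sub>m (k - k div 2)"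
        using pow_mat_add[OF M[OF x(2)], of xs "k div 2" "k - k div 2"] by simp
      then show ?thesis using x M[OF x(2), of xs] unfolding u_def v_def
        by (simp add: scalar_prod_def atLeast0LessThan)
    qed
    then have "(\<lambda>x xs. \<Sum>l<m. u x l xs * v x l xs) ` ?I = mat_entries J {..2 ^ Suc r'} m M"
      unfolding mat_entries_def by (intro image_cong refl) (auto simp: fun_eq_iff split: prod.splits)
    moreover have "card ?I \<le> card J * Suc (2 ^ r) * m\<^sup>2"
    proof -
      have "Suc (2 ^ Suc r') \<le> Suc (2 ^ r :: nat)"
        using Suc.prems by (simp only: Suc_le_mono) (rule power_increasing, auto)
      then have "card J * (Suc (2 ^ Suc r') * (m * m)) \<le> card J * (Suc (2 ^ r) * (m * m))"
        by (intro mult_le_mono) auto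
      then show ?thesis by (simp only: card_cartesian_product card_atMost card_lessThan power2_eq_square mult.assoc)
    qed
    then have "card ?I * (2 * 2 ^ t) \<le> card J * Suc (2 ^ r) * m\<^sup>2 * (2 * 2 ^ t)"
      by (rule mult_le_mono1)
    ultimately show ?case
      by (elim slp_mono) (auto simp del: power_Suc)
  qed
  from this[of r] show ?thesis by simp
qed

text \<open>There are five stages: the powers of M, their traces, the entries of L, the powers of L,
  and the signed sum for det M. Their depths t (t + 1), t, 1, t (t + 1) and t + 1 add up to 2 (t +
  1)^2. Since L has size m + 1, it is m + 1 that 2^t has to bound.\<close>

lemma slp_det:
  fixes M :: "'j \<Rightarrow> real list \<Rightarrow> real mat"
  assumes F: "slp N s d F" and J: "finite J"
    and const: "(\<lambda>xs. 0) \<in> F" "(\<lambda>xs. 1) \<in> F" "(\<lambda>xs. (-1) ^ m) \<in> F"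
    and inv: "\<And>k. 0 < k \<Longrightarrow> k \<le> m \<Longrightarrow> (\<lambda>xs. - 1 / real k) \<in> F"
    and m: "Suc m \<le> 2 ^ t"
    and M: "\<And>p xs. p \<in> J \<Longrightarrow> M p xs \<in> carrier_mat m m"
    and entries: "\<And>p i j. p \<in> J \<Longrightarrow> i < m \<Longrightarrow> j < m \<Longrightarrow> (\<lambda>xs. M p xs $$ (i,j)) \<in> F"
  shows "slp N (s + card J * (12 * (2 ^ t) ^ 5)) (d + 2 * (Suc t)\<^sup>2) (F \<union> (\<lambda>p xs. det (M p xs)) ` J)"
proof -
  let ?q = "2 ^ t :: nat"
  have m': "m \<le> ?q" using m by simp
  define P where "P r = t * (card J * Suc ?q * r\<^sup>2 * (2 * ?q))" for r
  define L where "L p xs = csanky_mat (M p xs)" for p xs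
  have L: "L p xs \<in> carrier_mat (Suc m) (Suc m)" if "p \<in> J" for p xs
    using M[OF that, of xs] by (simp add: L_def csanky_mat_def)
  have mem: "(\<lambda>xs. (M' p xs ^\<^sub>m k) $$ (i,j)) \<in> mat_entries J {..?q} m' M'"
    if "p \<in> J" "k \<le> ?q" "i < m'" "j < m'" for p k i j m' and M' :: "'j \<Rightarrow> real list \<Rightarrow> real mat"
    using that unfolding mat_entries_def by (intro image_eqI[of _ _ "(p,k,i,j)"]) auto

  define F1 where "F1 = F \<union> mat_entries J {..?q} m M"
  have F1: "slp N (s + P m) (d + t * Suc t) F1"
    unfolding F1_def P_def using F J const(1,2) m' M entries by (rule slp_mat_pow)

  define tr where "tr = (\<lambda>(p,k) xs. \<Sum>l<m. (M p xs ^\<^sub>m k) $$ (l,l))"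
  define F2 where "F2 = F1 \<union> tr ` (J \<times> {..m})"
  have F2: "slp N (s + P m + card (J \<times> {..m}) * ?q) (d + t * Suc t + t) F2"
  proof -
    have "slp N (s + P m + card (J \<times> {..m}) * ?q) (d + t * Suc t + t) (F1 \<union>
        (\<lambda>x xs. \<Sum>l<m. (case x of (p,k) \<Rightarrow> \<lambda>l xs. (M p xs ^\<^sub>m k) $$ (l,l)) l xs) ` (J \<times> {..m}))"
      using F1 J const m' by (intro slp_sum) (auto simp: F1_def intro!: mem)
    moreover have "(\<lambda>x xs. \<Sum>l<m. (case x of (p,k) \<Rightarrow> \<lambda>l xs. (M p xs ^\<^sub>m k) $$ (l,l)) l xs) = tr"
      by (auto simp: tr_def fun_eq_iff)
    ultimately show ?thesis unfolding F2_def by (simp only:)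
  qed

  define lentry where "lentry = (\<lambda>(p,k,j) xs. L p xs $$ (k,j))"
  define F3 where "F3 = F2 \<union> lentry ` (J \<times> {..m} \<times> {..m})"
  have F3: "slp N (s + P m + card (J \<times> {..m}) * ?q + card (J \<times> {..m} \<times> {..m})) (Suc (d + t * Suc t + t)) F3"
    unfolding F3_def
  proof (intro slp_image F2)
    fix x assume "x \<in> J \<times> {..m} \<times> {..m}"
    then obtain p k j where x: "x = (p,k,j)" "p \<in> J" "k \<le> m" "j \<le> m" by auto
    \<comment> \<open>The zero entries are produced by a gate as well, \<open>0 * 0\<close>, so that
      all entries of L form one uniform layer.\<close>
    have "lentry x = (if j < k then (\<lambda>xs. (- 1 / real k) * tr (p, k - j) xs) else (\<lambda>xs. 0 * 0))"
      using x carrier_matD(1)[OF M[OF x(2)]] by (auto simp: lentry_def L_def csanky_mat_def tr_def mat_trace_def fun_eq_iff)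
    moreover have "one_gate F2 (\<lambda>xs. (- 1 / real k) * tr (p, k - j) xs)" if "j < k"
      using x that inv[of k] by (intro one_gate.mult) (auto simp: F2_def F1_def)
    moreover have "one_gate F2 (\<lambda>xs. 0 * 0)"
      using const(1) by (intro one_gate.mult[of "\<lambda>xs. 0" _ "\<lambda>xs. 0"]) (auto simp: F2_def F1_def)
    ultimately show "one_gate F2 (lentry x)" by simp
  qed (use J in auto)

  let ?s3 = "s + P m + card (J \<times> {..m}) * ?q + card (J \<times> {..m} \<times> {..m})"
  let ?d3 = "Suc (d + t * Suc t + t)"
  define F4 where "F4 = F3 \<union> mat_entries J {..?q} (Suc m) L"
  have F4: "slp N (?s3 + P (Suc m)) (?d3 + t * Suc t) F4"
    unfolding F4_def P_def[of "Suc m"]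
  proof (rule slp_mat_pow[OF F3 J _ _ m L])
    show "(\<lambda>xs. 0) \<in> F3" "(\<lambda>xs. 1) \<in> F3" using const by (auto simp: F3_def F2_def F1_def)
    fix p i j assume "p \<in> J" "i < Suc m" "j < Suc m"
    then show "(\<lambda>xs. L p xs $$ (i,j)) \<in> F3"
      unfolding F3_def lentry_def by (intro UnI2 image_eqI[of _ _ "(p,i,j)"]) auto
  qed

  \<comment> \<open>The sign (-1)^m is distributed over the sum as a constant left factor, so the
    last stage is again a dot product.\<close>
  have dets: "slp N (?s3 + P (Suc m) + card J * (2 * ?q)) (Suc (?d3 + t * Suc t) + t)
      (F4 \<union> (\<lambda>p xs. \<Sum>i<Suc m. (\<lambda>xs. (-1) ^ m) xs * (L p xs ^\<^sub>m i) $$ (m,0)) ` J)"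
  proof (intro slp_dot F4 J m)
    show "(\<lambda>xs. 0) \<in> F4" "(\<lambda>xs. (-1) ^ m) \<in> F4" using const by (auto simp: F4_def F3_def F2_def F1_def)
    fix p i assume "p \<in> J" "i < Suc m"
    then show "(\<lambda>xs. (L p xs ^\<^sub>m i) $$ (m,0)) \<in> F4"
      using m unfolding F4_def by (intro UnI2 mem) auto
  qed
  have eq: "(\<lambda>p xs. \<Sum>i<Suc m. (\<lambda>xs. (-1) ^ m) xs * (L p xs ^\<^sub>m i) $$ (m,0)) ` J
      = (\<lambda>p xs. det (M p xs)) ` J"
    using det_csanky[OF M]
    by (intro image_cong refl) (simp add: fun_eq_iff L_def sum_distrib_left lessThan_Suc_atMost)
  \<comment> \<open>12 = 4 + 1 + 1 + 4 + 2, one share for each of the five stages, each rounded up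
    to a multiple of \<open>card J * ?q ^ 5\<close>.\<close>
  have size: "?s3 + P (Suc m) + card J * (2 * ?q) \<le> s + card J * (12 * ?q ^ 5)"
  proof -
    have q1: "1 \<le> ?q" and tq: "t \<le> ?q" by (simp_all add: less_imp_le)
    have alg: "x * (c * (2 * x) * x\<^sup>2 * (2 * x)) = c * (4 * x ^ 5)" for x c :: nat
    proof -
      have "x ^ 5 = x * x * x * x * x" by (simp add: eval_nat_numeral)
      then show ?thesis by (simp add: power2_eq_square ac_simps)
    qed
    have P: "P r \<le> card J * (4 * ?q ^ 5)" if "r \<le> ?q" for r
    proof -
      have "P r \<le> ?q * (card J * (2 * ?q) * ?q\<^sup>2 * (2 * ?q))"
        unfolding P_def using that tq q1 by (intro mult_le_mono power_mono) auto
      also have "\<dots> = card J * (4 * ?q ^ 5)" by (rule alg)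
      finally show ?thesis .
    qed
    have pw: "?q ^ k \<le> ?q ^ 5" if "k \<le> 5" for k using that by (intro power_increasing) auto
    have "card (J \<times> {..m}) * ?q \<le> card J * ?q ^ 2"
      using mult_le_mono1[OF mult_le_mono2[OF m, of "card J"], of ?q]
      by (simp add: card_cartesian_product power2_eq_square mult.assoc)
    also have "\<dots> \<le> card J * ?q ^ 5" by (intro mult_le_mono pw) auto
    finally have A: "card (J \<times> {..m}) * ?q \<le> card J * ?q ^ 5" .
    have "card (J \<times> {..m} \<times> {..m}) \<le> card J * ?q ^ 2"
      using mult_le_mono2[OF mult_le_mono[OF m m], of "card J"]
      by (simp only: card_cartesian_product card_atMost power2_eq_square)
    also have "\<dots> \<le> card J * ?q ^ 5" by (intro mult_le_mono pw) auto
    finally have B: "card (J \<times> {..m} \<times> {..m}) \<le> card J * ?q ^ 5" .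
    have C: "card J * (2 * ?q) \<le> card J * (2 * ?q ^ 5)" using pw[of 1] by (intro mult_le_mono) auto
    have "?s3 + P (Suc m) + card J * (2 * ?q)
        \<le> s + card J * (4 * ?q ^ 5) + card J * ?q ^ 5 + card J * ?q ^ 5
            + card J * (4 * ?q ^ 5) + card J * (2 * ?q ^ 5)"
      by (intro add_mono order_refl P m m' A B C)
    also have "\<dots> = s + card J * (12 * ?q ^ 5)" by simp
    finally show ?thesis .
  qed
  have depth: "Suc (?d3 + t * Suc t) + t \<le> d + 2 * (Suc t)\<^sup>2"
    by (simp add: power2_eq_square algebra_simps)
  have "F \<subseteq> F4" unfolding F4_def F3_def F2_def F1_def by blast
  then show ?thesis by (intro slp_mono[OF dets[unfolded eq] size depth] Un_mono subset_refl)
qed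

lemma slp_circuit:
  assumes "slp N s d (f ` {..<m})"
  shows "\<exists>C. wf_circuit N C \<and> circuit_size C \<le> s \<and> circuit_depth C \<le> d \<and>
    (\<forall>xs. length xs = N \<longrightarrow> circuit_eval C xs = map (\<lambda>i. f i xs) [0..<m])"
proof -
  obtain G where G: "wf_gates N G" "length G \<le> s" "\<forall>k<length G. gate_depths G ! k \<le> d"
    "\<forall>h\<in>f ` {..<m}. \<exists>k. computes N G h k" using assms unfolding slp_def by blast
  then have "\<forall>i. \<exists>k. i < m \<longrightarrow> computes N G (f i) k" by blast
  then obtain out where out: "\<And>i. i < m \<Longrightarrow> computes N G (f i) (out i)" by metis
  let ?C = "Arith_Circuit G (map out [0..<m])"
  have "wf_circuit N ?C" using G(1) out by (auto simp: wf_circuit_def wf_gates_def computes_def)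
  moreover have "circuit_size ?C \<le> s" using G(2) by (simp add: circuit_size_def)
  moreover have "circuit_depth ?C \<le> d"
    using G(3) unfolding circuit_depth_def arith_circuit.sel gate_depths_def[symmetric]
    by (auto simp: in_set_conv_nth)
  moreover have "circuit_eval ?C xs = map (\<lambda>i. f i xs) [0..<m]" if "length xs = N" for xs
    using out that unfolding circuit_eval_def arith_circuit.sel gate_values_def[symmetric]
    by (auto simp: computes_def)
  ultimately show ?thesis by blast
qed

section \<open>Circuits for the coefficient vector b\<close>

definition input_points :: "nat \<Rightarrow> real list \<Rightarrow> nat \<Rightarrow> real Matrix.vec" where
  "input_points n xs j = Matrix.vec n (\<lambda>k. xs ! (j * n + k))"

definition point_minor :: "nat \<Rightarrow> (nat \<Rightarrow> real Matrix.vec) \<Rightarrow> nat \<Rightarrow> real mat" where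
  "point_minor n a i =
     mat_of_cols (n + 1) (map (\<lambda>j. vCons 1 (a j)) (filter (\<lambda>j. j \<noteq> i) [0..<n + 2]))"

text \<open>This makes the columns of a minor addressable by number: those from i on are shifted by
  one.\<close>

lemma filter_neq_upt:
  "i < Suc m \<Longrightarrow> filter (\<lambda>j. j \<noteq> i) [0..<Suc m] = map (\<lambda>k. if k < i then k else Suc k) [0..<m]"
proof (induction m)
  case (Suc m)
  show ?case
  proof (cases "i = Suc m")
    case True
    have "filter (\<lambda>j. j \<noteq> Suc m) [0..<Suc m] = [0..<Suc m]" by (rule filter_True) auto
    moreover have "map (\<lambda>k. if k < Suc m then k else Suc k) [0..<Suc m] = map id [0..<Suc m]"
      by (rule map_cong) auto
    ultimately show ?thesis using True by simp
  next
    case False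
    then have "filter (\<lambda>j. j \<noteq> i) [0..<Suc (Suc m)] = filter (\<lambda>j. j \<noteq> i) [0..<Suc m] @ [Suc m]"
      by simp
    also have "filter (\<lambda>j. j \<noteq> i) [0..<Suc m] = map (\<lambda>k. if k < i then k else Suc k) [0..<m]"
      using Suc False by simp
    finally show ?thesis using False Suc.prems by simp
  qed
qed simp

lemma point_minor_eq:
  assumes "i < n + 2"
  shows "point_minor n a i =
    mat_of_cols (n + 1) (map (\<lambda>k. vCons 1 (a (if k < i then k else Suc k))) [0..<n + 1])"
proof -
  have *: "n + 2 = Suc (n + 1)" by simp
  have "filter (\<lambda>j. j \<noteq> i) [0..<n + 2] = map (\<lambda>k. if k < i then k else Suc k) [0..<n + 1]"
    unfolding * by (rule filter_neq_upt) (use assms in simp)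
  then show ?thesis by (simp only: point_minor_def map_map comp_def)
qed

lemma point_minor_carrier: "i < n + 2 \<Longrightarrow> point_minor n a i \<in> carrier_mat (n + 1) (n + 1)"
  using mat_of_cols_carrier(1)[of "n + 1" "map (\<lambda>k. vCons 1 (a (if k < i then k else Suc k))) [0..<n + 1]"]
  by (simp only: point_minor_eq length_map length_upt diff_zero)

lemma point_minor_index:
  assumes "i < n + 2" "r < n + 1" "k < n + 1"
  shows "point_minor n a i $$ (r,k) = vCons 1 (a (if k < i then k else Suc k)) $ r"
  using assms(2,3) by (simp add: point_minor_eq[OF assms(1)] mat_of_cols_index del: upt_Suc)

lemma circuit_coeff_eq: "circuit_coeff n a i = (-1) ^ (i + 1) * det (point_minor n a i)"
  unfolding circuit_coeff_def point_minor_def by (rule refl)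

lemma slp_circuit_coeff:
  assumes t: "n + 2 \<le> 2 ^ t"
  shows "slp (n * (n + 2)) (n * (n + 2) + 2 * (n + 2) + (n + 2) * (12 * (2 ^ t) ^ 5) + (n + 2))
    (Suc (2 * (Suc t)\<^sup>2)) ((\<lambda>i xs. circuit_coeff n (input_points n xs) i) ` {..<n + 2})"
proof -
  let ?N = "n * (n + 2)"
  \<comment> \<open>0 pads the sums, 1 serves the row of ones and the zeroth powers, -1 the signs,
    and the -1/k replace the divisions in Newton's identities for minors of size n + 1.\<close>
  define C where "C = {0, 1, -1} \<union> (\<lambda>k. - 1 / real k) ` {1..n+1}"
  define F where "F = (\<lambda>i xs. xs ! i) ` {..<?N} \<union> (\<lambda>c xs. c :: real) ` C"
  have "card C \<le> card {0, 1, -1 :: real} + card ((\<lambda>k. - 1 / real k) ` {1..n+1})"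
    unfolding C_def by (rule card_Un_le)
  also have "card ((\<lambda>k. - 1 / real k) ` {1..n+1}) \<le> n + 1"
    using card_image_le[of "{1..n+1}" "\<lambda>k. - 1 / real k"] by simp
  also have "card {0, 1, -1 :: real} = 3" by simp
  finally have card: "card C \<le> 2 * (n + 2)" by simp
  have const: "(\<lambda>xs. c) \<in> F" if "c \<in> C" for c using that by (auto simp: F_def)
  have pm: "(-1) ^ k \<in> C" for k by (cases "even k") (auto simp: C_def)
  have "slp ?N (?N + card C) 0 F"
    unfolding F_def by (rule slp_inputs_consts) (simp add: C_def)
  then have "slp ?N (?N + 2 * (n + 2)) 0 F" using card by (elim slp_mono) auto
  then have "slp ?N (?N + 2 * (n + 2) + card {..<n+2} * (12 * (2 ^ t) ^ 5)) (0 + 2 * (Suc t)\<^sup>2)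
    (F \<union> (\<lambda>i xs. det (point_minor n (input_points n xs) i)) ` {..<n + 2})"
  proof (rule slp_det[where m = "n + 1"])
    show "(\<lambda>xs. 0) \<in> F" "(\<lambda>xs. 1) \<in> F" "(\<lambda>xs. (-1) ^ (n + 1)) \<in> F"
      using pm[of "n+1"] by (auto intro!: const simp: C_def)
    show "(\<lambda>xs. - 1 / real k) \<in> F" if "0 < k" "k \<le> n + 1" for k
      using that by (intro const) (auto simp: C_def)
    show "Suc (n + 1) \<le> 2 ^ t" using t by simp
    fix i r k assume i: "i \<in> {..<n+2}"
    then show "point_minor n (input_points n xs) i \<in> carrier_mat (n + 1) (n + 1)" for xs
      by (simp only: lessThan_iff point_minor_carrier)
    assume "r < n + 1" "k < n + 1"
    then have eq: "point_minor n (input_points n xs) i $$ (r,k)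
        = (case r of 0 \<Rightarrow> 1 | Suc r' \<Rightarrow> xs ! ((if k < i then k else Suc k) * n + r'))" for xs
      using i by (simp add: point_minor_index input_points_def split: nat.split)
    show "(\<lambda>xs. point_minor n (input_points n xs) i $$ (r,k)) \<in> F"
    proof (cases r)
      case 0
      then show ?thesis unfolding eq by (auto intro!: const simp: C_def)
    next
      case (Suc r')
      let ?j = "if k < i then k else Suc k"
      have "Suc ?j \<le> n + 2" using \<open>k < n + 1\<close> by simp
      then have "Suc ?j * n \<le> (n + 2) * n" by (rule mult_le_mono1)
      moreover have "?j * n + r' < Suc ?j * n" using \<open>r < n + 1\<close> Suc by simp
      ultimately have "?j * n + r' < ?N" by (simp add: mult.commute)
      moreover have "(\<lambda>xs. point_minor n (input_points n xs) i $$ (r,k)) = (\<lambda>xs. xs ! (?j * n + r'))"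
        unfolding eq by (simp only: Suc nat.case)
      ultimately show ?thesis unfolding F_def by (intro UnI1 image_eqI) (assumption, simp only: lessThan_iff)
    qed
  qed simp
  then have "slp ?N (?N + 2 * (n + 2) + card {..<n+2} * (12 * (2 ^ t) ^ 5) + card {..<n+2})
    (Suc (0 + 2 * (Suc t)\<^sup>2))
    (F \<union> (\<lambda>i xs. det (point_minor n (input_points n xs) i)) ` {..<n + 2} \<union>
      (\<lambda>i xs. (-1) ^ (i + 1) * det (point_minor n (input_points n xs) i)) ` {..<n + 2})"
  proof (rule slp_image)
    fix i assume i: "i \<in> {..<n + 2}"
    show "one_gate (F \<union> (\<lambda>i xs. det (point_minor n (input_points n xs) i)) ` {..<n + 2})
        (\<lambda>xs. (-1) ^ (i + 1) * det (point_minor n (input_points n xs) i))"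
    proof (rule one_gate.mult)
      show "(\<lambda>xs. (-1) ^ (i + 1)) \<in> F \<union> (\<lambda>i xs. det (point_minor n (input_points n xs) i)) ` {..<n + 2}"
        by (rule UnI1) (rule const[OF pm])
      show "(\<lambda>xs. det (point_minor n (input_points n xs) i))
          \<in> F \<union> (\<lambda>i xs. det (point_minor n (input_points n xs) i)) ` {..<n + 2}"
        by (rule UnI2, rule image_eqI[OF refl i])
    qed
  qed simp
  from slp_mono[OF this _ _ Un_upper2] show ?thesis unfolding circuit_coeff_eq by simp
qed

text \<open>Rounding the dimension up to a power of two at most doubles it, which keeps the size
  polynomial.\<close>

lemma exists_pow2_between: "0 < m \<Longrightarrow> \<exists>t. m \<le> 2 ^ t \<and> 2 ^ t \<le> 2 * (m :: nat)"
proof (induction m rule: nat_induct_non_zero)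
  case 1
  show ?case by (intro exI[of _ 0]) simp
next
  case (Suc m)
  then obtain t where t: "m \<le> 2 ^ t" "2 ^ t \<le> 2 * m" by blast
  show ?case
  proof (cases "m = 2 ^ t")
    case True
    then show ?thesis by (intro exI[of _ "Suc t"]) simp
  next
    case False
    then show ?thesis using t by (intro exI[of _ t]) simp
  qed
qed

lemma nth_concat_uniform:
  assumes "\<And>ys. ys \<in> set xss \<Longrightarrow> length ys = n" "j < length xss" "k < n"
  shows "concat xss ! (j * n + k) = xss ! j ! k"
  using assms
proof (induction xss arbitrary: j)
  case (Cons ys xss)
  then show ?case by (cases j) (auto simp: nth_append)
qed simp

text \<open>The number N = n (n + 2) of inputs determines n, so one circuit per N serves all tuples
  of points; every other N gets the empty circuit. The bounds are proved from N = 3 on, the value at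
  n = 1.\<close>

lemma NC_R_circuit_coeff: "NC_R 2 circuit_coeff_graph"
proof -
  have ex: "\<exists>C. wf_circuit N C \<and>
      (3 \<le> N \<longrightarrow> real (circuit_size C) \<le> 400 * real N ^ 6 \<and> real (circuit_depth C) \<le> 40 * ln (real N) ^ 2) \<and>
      (\<forall>n xs. length xs = N \<longrightarrow> N = n * (n + 2) \<longrightarrow>
         circuit_eval C xs = map (circuit_coeff n (input_points n xs)) [0..<n + 2])" for N
  proof (cases "\<exists>n. N = n * (n + 2)")
    case False
    then show ?thesis
      by (intro exI[of _ "Arith_Circuit [] []"])
        (auto simp: wf_circuit_def circuit_size_def circuit_depth_def)
  next
    case True
    then obtain n where n: "N = n * (n + 2)" by blast
    obtain t where t: "n + 2 \<le> 2 ^ t" "2 ^ t \<le> 2 * (n + 2)"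
      using exists_pow2_between[of "n + 2"] by auto
    from slp_circuit[OF slp_circuit_coeff[OF t(1)]] obtain C where C: "wf_circuit N C"
      "circuit_size C \<le> n * (n + 2) + 2 * (n + 2) + (n + 2) * (12 * (2 ^ t) ^ 5) + (n + 2)"
      "circuit_depth C \<le> Suc (2 * (Suc t)\<^sup>2)"
      "\<And>xs. length xs = N \<Longrightarrow>
        circuit_eval C xs = map (\<lambda>i. circuit_coeff n (input_points n xs) i) [0..<n + 2]"
      unfolding n by blast
    \<comment> \<open>Completing the square: N + 1 = (n + 1)^2.\<close>
    have uniq: "n' = n" if "N = n' * (n' + 2)" for n'
    proof -
      have "(n' + 1)\<^sup>2 = (n + 1)\<^sup>2" using that n by (simp add: power2_eq_square)
      then show ?thesis by (simp add: power2_eq_iff)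
    qed
    have "real (circuit_size C) \<le> 400 * real N ^ 6 \<and> real (circuit_depth C) \<le> 40 * ln (real N) ^ 2"
      if N: "3 \<le> N"
    proof
      have "1 \<le> n" using N n by (cases n) auto
      then have n2: "n + 2 \<le> N" using mult_le_mono1[of 1 n "n + 2"] unfolding n by simp
      have p: "N \<le> N ^ 6" using N by (intro self_le_power) auto
      \<comment> \<open>384 = 12 * 2^5, because 2^t <= 2 (n + 2) <= 2 N. The linear terms, 4 N in
        total, fit into the rest of 400 N^6.\<close>
      have "(2 ^ t) ^ 5 \<le> (2 * N) ^ 5" using t(2) n2 by (intro power_mono) auto
      then have "(n + 2) * (12 * (2 ^ t) ^ 5) \<le> N * (12 * (2 * N) ^ 5)"
        using n2 by (intro mult_le_mono) auto
      also have "\<dots> = 384 * N ^ 6" by (simp add: power_mult_distrib flip: power_Suc)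
      finally have "(n + 2) * (12 * (2 ^ t) ^ 5) \<le> 384 * N ^ 6" .
      then have "circuit_size C \<le> N + 2 * N + 384 * N ^ 6 + N"
        using n2 by (intro order_trans[OF C(2)[folded n]] add_mono mult_le_mono2 order_refl)
      also have "\<dots> \<le> 400 * N ^ 6" using p by linarith
      finally have "real (circuit_size C) \<le> real (400 * N ^ 6)" by (simp only: of_nat_le_iff)
      then show "real (circuit_size C) \<le> 400 * real N ^ 6"
        by (simp only: of_nat_mult of_nat_power of_nat_numeral)
      \<comment> \<open>N >= 3 > e gives ln N >= 1, which absorbs additive constants: t <= 1 + 2 ln
        N yields t + 1 <= 4 ln N, and 1 + 2 * 16 <= 40.\<close>
      have ln: "1 \<le> ln (real N)"
      proof -
        have "exp 1 \<le> real N" using exp_le N by linarith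
        then show ?thesis using N by (simp add: ln_ge_iff)
      qed
      have "2 ^ t \<le> 2 * N" using t(2) mult_le_mono2[OF n2, of 2] by (rule order_trans)
      then have "real (2 ^ t) \<le> real (2 * N)" by (simp only: of_nat_le_iff)
      then have "ln (2 ^ t) \<le> ln (2 * real N)" using N by (subst ln_le_cancel_iff) auto
      then have "real t * ln 2 \<le> ln 2 + ln (real N)"
        using N by (simp add: ln_realpow ln_mult)
      moreover have "1 / 2 \<le> ln (2 :: real)"
      proof -
        have "1 \<le> ln (2 ^ 2 :: real)" using exp_le by (subst ln_ge_iff) auto
        then show ?thesis by (subst (asm) ln_realpow) auto
      qed
      then have "ln (real N) * (1 / 2) \<le> ln (real N) * ln 2" using ln by (intro mult_left_mono) auto
      ultimately have "real t * ln 2 \<le> (1 + 2 * ln (real N)) * ln 2" by (simp add: algebra_simps)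
      then have "real t \<le> 1 + 2 * ln (real N)" by simp
      then have "real (Suc t) \<le> 4 * ln (real N)" using ln by simp
      then have "(real (Suc t))\<^sup>2 \<le> (4 * ln (real N))\<^sup>2" by (intro power_mono) auto
      moreover have "1 \<le> (ln (real N))\<^sup>2" using ln by simp
      moreover have "real (circuit_depth C) \<le> real (Suc (2 * (Suc t)\<^sup>2))"
        using C(3) by (simp only: of_nat_le_iff)
      ultimately show "real (circuit_depth C) \<le> 40 * ln (real N) ^ 2"
        by (simp add: power_mult_distrib)
    qed
    then show ?thesis using C(1,4) uniq by (intro exI[of _ C]) blast
  qed
  then obtain C where C: "\<And>N. wf_circuit N (C N)"
    "\<And>N. 3 \<le> N \<Longrightarrow> real (circuit_size (C N)) \<le> 400 * real N ^ 6"
    "\<And>N. 3 \<le> N \<Longrightarrow> real (circuit_depth (C N)) \<le> 40 * ln (real N) ^ 2"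
    "\<And>n xs. length xs = n * (n + 2) \<Longrightarrow>
      circuit_eval (C (length xs)) xs = map (circuit_coeff n (input_points n xs)) [0..<n + 2]"
    using choice[of "\<lambda>N C. wf_circuit N C \<and>
      (3 \<le> N \<longrightarrow> real (circuit_size C) \<le> 400 * real N ^ 6 \<and> real (circuit_depth C) \<le> 40 * ln (real N) ^ 2) \<and>
      (\<forall>n xs. length xs = N \<longrightarrow> N = n * (n + 2) \<longrightarrow>
         circuit_eval C xs = map (circuit_coeff n (input_points n xs)) [0..<n + 2])"] by blast
  have large: "eventually (\<lambda>N. 3 \<le> N) (sequentially)" by (rule eventually_ge_at_top)
  show ?thesis unfolding NC_R_def
  proof (intro exI[of _ C] conjI allI)
    show "\<exists>d. (\<lambda>N. real (circuit_size (C N))) \<in> O(\<lambda>N. real N ^ d)"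
      by (intro exI[of _ 6] bigoI[of _ 400] eventually_mono[OF large]) (simp add: C(2))
    show "(\<lambda>N. real (circuit_depth (C N))) \<in> O(\<lambda>N. ln (real N) ^ 2)"
      by (intro bigoI[of _ 40] eventually_mono[OF large]) (simp add: C(3))
    show "\<forall>(xs, zs)\<in>circuit_coeff_graph. circuit_eval (C (length xs)) xs = zs"
    proof
      fix z assume "z \<in> circuit_coeff_graph"
      then obtain n a
        where z: "z = (concat (map (\<lambda>i. list_of_vec (a i)) [0..<n + 2]), map (circuit_coeff n a) [0..<n + 2])"
          and circ: "nondegenerate_circuit n (a ` {..<n + 2})"
        unfolding circuit_coeff_graph_def by blast
      define xss where "xss = map (\<lambda>i. list_of_vec (a i)) [0..<n + 2]"
      have "a ` {..<n + 2} \<subseteq> carrier_vec n"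
        using circ unfolding nondegenerate_circuit_def by (elim conjE)
      then have a: "a i \<in> carrier_vec n" if "i < n + 2" for i
        using that by (simp add: image_subset_iff)
      have xss: "length xss = n + 2" "\<And>j. j < n + 2 \<Longrightarrow> xss ! j = list_of_vec (a j)"
        by (auto simp: xss_def simp del: upt_Suc)
      have lens: "length ys = n" if "ys \<in> set xss" for ys
        using that a unfolding xss_def by (auto simp del: upt_Suc)
      then have "map length xss = map (\<lambda>_. n) xss" by (intro map_cong) auto
      then have len: "length (concat xss) = n * (n + 2)"
        by (simp only: length_concat sum_list_triv xss(1)) simp
      have pt: "input_points n (concat xss) j = a j" if j: "j < n + 2" for j
      proof (rule eq_vecI)
        fix k assume "k < dim_vec (a j)"
        then have k: "k < n" using a[OF j] by simp
        then have "concat xss ! (j * n + k) = xss ! j ! k"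
          using lens j xss(1) by (intro nth_concat_uniform) auto
        then show "input_points n (concat xss) j $ k = a j $ k"
          using k a[OF j] xss(2)[OF j] by (simp add: input_points_def list_of_vec_index)
      qed (use a[OF j] in \<open>simp add: input_points_def\<close>)
      \<comment> \<open>This holds for every i, also beyond n + 1, because only points with index
        below n + 2 enter; hence the two coefficient functions are equal.\<close>
      have "circuit_coeff n (input_points n (concat xss)) i = circuit_coeff n a i" for i
      proof -
        have "map (\<lambda>j. vCons 1 (input_points n (concat xss) j)) (filter (\<lambda>j. j \<noteq> i) [0..<n + 2])
            = map (\<lambda>j. vCons 1 (a j)) (filter (\<lambda>j. j \<noteq> i) [0..<n + 2])"
          using pt by (intro map_cong refl) (auto simp del: upt_Suc)
        then show ?thesis by (simp only: circuit_coeff_def)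
      qed
      then have "circuit_coeff n (input_points n (concat xss)) = circuit_coeff n a" by (rule ext)
      then show "case z of (xs, zs) \<Rightarrow> circuit_eval (C (length xs)) xs = zs"
        unfolding z xss_def[symmetric] prod.case C(4)[OF len] by (simp only:)
    qed
  qed (rule C(1))
qed

section \<open>Affine relations of a circuit of points\<close>

lemma scalar_prod_lessThan: "v \<bullet> w = (\<Sum>k<dim_vec w. v $ k * w $ k)"
  by (simp add: scalar_prod_def atLeast0LessThan)

lemma sum_vCons_mult:
  "(\<Sum>r<n + 1. vCons x v $ r * vCons y w $ r) = x * y + (\<Sum>k<n. v $ k * (w $ k :: 'a::comm_semiring_1))"
  unfolding Suc_eq_plus1[symmetric] sum.lessThan_Suc_shift by simp

text \<open>Being a circuit is a property of the set of points, while b depends on their numbering;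
  injectivity translates between the two.\<close>

locale point_circuit =
  fixes n :: nat and a :: "nat \<Rightarrow> real Matrix.vec"
  assumes inj: "inj_on a {..<n + 2}" and circuit: "nondegenerate_circuit n (a ` {..<n + 2})"
begin

abbreviation b :: "nat \<Rightarrow> real" where "b \<equiv> circuit_coeff n a"

text \<open>Homogenisation turns affine relations into linear ones: entry 0 says that the
  coefficients sum to zero, the later entries treat the coordinates.\<close>

abbreviation hom :: "nat \<Rightarrow> real Matrix.vec" where "hom i \<equiv> vCons 1 (a i)"

lemma point_carrier: "i < n + 2 \<Longrightarrow> a i \<in> carrier_vec n"
  using circuit by (auto simp only: nondegenerate_circuit_def)

text \<open>Minimality of the circuit in indexed form: by injectivity, omitting a_i leaves a proper
  subset, and \<open>u\<close> carries the coefficients from indices to points.\<close>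

lemma omit_one_independent:
  assumes i: "i < n + 2" and rel: "\<And>r. r < n + 1 \<Longrightarrow> (\<Sum>j\<in>{..<n + 2} - {i}. w j * hom j $ r) = 0"
    and j: "j < n + 2" "j \<noteq> i"
  shows "w j = 0"
proof (rule ccontr)
  assume "w j \<noteq> 0"
  let ?J = "{..<n + 2} - {i}"
  define u where "u = w \<circ> the_inv_into {..<n + 2} a"
  have u: "u (a k) = w k" if "k < n + 2" for k
    using the_inv_into_f_f[OF inj] that by (simp add: u_def)
  have inj': "inj_on a ?J" using inj by (rule inj_on_subset) auto
  have sum: "(\<Sum>x\<in>a ` ?J. u x * f x) = (\<Sum>k\<in>?J. w k * f (a k))" for f
    by (subst sum.reindex[OF inj']) (auto simp: u intro!: sum.cong)
  have "affinely_dependent n (a ` ?J)" unfolding affinely_dependent_def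
  proof (intro exI[of _ u] conjI allI impI)
    show "(\<Sum>x\<in>a ` ?J. u x) = 0" using sum[of "\<lambda>_. 1"] rel[of 0] by simp
    show "\<exists>x\<in>a ` ?J. u x \<noteq> 0" using j u \<open>w j \<noteq> 0\<close> by (intro bexI[of _ "a j"]) auto
    show "(\<Sum>x\<in>a ` ?J. u x * x $ r) = 0" if "r < n" for r
      using sum[of "\<lambda>x. x $ r"] rel[of "Suc r"] that by simp
  qed
  moreover have "a i \<notin> a ` ?J" using inj i by (auto dest: inj_onD)
  then have "a ` ?J \<subset> a ` {..<n + 2}" using i by blast
  ultimately show False using circuit by (simp only: nondegenerate_circuit_def)
qed

text \<open>
  Expand a matrix with a repeated row along that row: the cofactors are the coefficients b up to sign.
\<close>

lemma coeff_relation: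
  assumes r: "r < n + 1"
  shows "(\<Sum>i<n + 2. b i * hom i $ r) = 0"
proof -
  define E where "E = mat (n + 2) (n + 2) (\<lambda>(p,i). if p = 0 then hom i $ r else hom i $ (p - 1))"
  have E: "E \<in> carrier_mat (n + 2) (n + 2)" by (simp add: E_def)
  have "det E = 0"
  proof (rule Determinant.det_identical_rows[OF E])
    show "row E 0 = row E (Suc r)" using r by (intro eq_vecI) (auto simp: E_def)
  qed (use r in auto)
  \<comment> \<open>The cofactor has the sign (-1)^(0 + i) and b the sign (-1)^(i + 1), so they
    differ by a factor -1 that is the same for all i.\<close>
  moreover have "cofactor E 0 i = - b i" if i: "i < n + 2" for i
  proof -
    have "mat_delete E 0 i = point_minor n a i"
    proof (rule eq_matI)
      fix p k assume "p < dim_row (point_minor n a i)" "k < dim_col (point_minor n a i)"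
      then have "p < n + 1" "k < n + 1" using point_minor_carrier[OF i, of a] by auto
      then show "mat_delete E 0 i $$ (p,k) = point_minor n a i $$ (p,k)"
        unfolding point_minor_index[OF i \<open>p < n + 1\<close> \<open>k < n + 1\<close>]
        by (simp add: mat_delete_def E_def)
    qed (use E point_minor_carrier[OF i, of a] in auto)
    then show ?thesis by (simp add: cofactor_def circuit_coeff_eq)
  qed
  then have "(\<Sum>i<n + 2. E $$ (0,i) * cofactor E 0 i) = (\<Sum>i<n + 2. - (b i * hom i $ r))"
    by (intro sum.cong) (auto simp: E_def)
  ultimately show ?thesis
    using laplace_expansion_row[OF E, of 0] by (simp add: sum_negf)
qed

text \<open>A vanishing minor has a nonzero kernel vector, that is, a nontrivial relation among the
  points other than a_i, against minimality.\<close>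

lemma coeff_nonzero:
  assumes i: "i < n + 2"
  shows "b i \<noteq> 0"
proof
  assume "b i = 0"
  let ?P = "point_minor n a i" and ?s = "\<lambda>k. if k < i then k else Suc k"
  have P: "?P \<in> carrier_mat (n + 1) (n + 1)" by (rule point_minor_carrier[OF i])
  have "det ?P = 0" using \<open>b i = 0\<close> by (simp add: circuit_coeff_eq)
  then obtain w where w: "w \<in> carrier_vec (n + 1)" "w \<noteq> 0\<^sub>v (n + 1)" "?P *\<^sub>v w = 0\<^sub>v (n + 1)"
    using det_0_iff_vec_prod_zero[OF P] by blast
  have bij: "bij_betw ?s {..<n + 1} ({..<n + 2} - {i})"
    by (rule bij_betw_byWitness[where f' = "\<lambda>j. if j < i then j else j - 1"]) (use i in auto)
  \<comment> \<open>Column k of the minor belongs to the point with index \<open>?s k\<close>;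
    \<open>w'\<close> renumbers the kernel vector accordingly.\<close>
  define w' where "w' j = w $ (if j < i then j else j - 1)" for j
  have w's: "w' (?s k) = w $ k" for k by (auto simp: w'_def)
  have "(\<Sum>j\<in>{..<n + 2} - {i}. w' j * hom j $ r) = 0" if r: "r < n + 1" for r
  proof -
    have "(\<Sum>j\<in>{..<n + 2} - {i}. w' j * hom j $ r) = (\<Sum>k<n + 1. w' (?s k) * hom (?s k) $ r)"
      by (rule sum.reindex_bij_betw[OF bij, symmetric])
    also have "\<dots> = (\<Sum>k<n + 1. ?P $$ (r,k) * w $ k)"
      using r by (intro sum.cong refl) (simp only: w's point_minor_index[OF i] lessThan_iff mult.commute)
    also have "\<dots> = (?P *\<^sub>v w) $ r" using P w(1) r by (simp add: scalar_prod_lessThan)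
    also have "\<dots> = 0" using w(3) r by simp
    finally show ?thesis .
  qed
  then have w'0: "w' j = 0" if "j < n + 2" "j \<noteq> i" for j
    using omit_one_independent[OF i] that by blast
  have "w $ k = 0" if "k < n + 1" for k
    using w'0[of "?s k"] that unfolding w's by auto
  then have "w = 0\<^sub>v (n + 1)" using w(1) by (intro eq_vecI) auto
  then show False using w(2) by contradiction
qed

text \<open>Subtracting the multiple of b that agrees at index 0 leaves a relation that omits point
  0, hence zero.\<close>

lemma relation_unique_real:
  fixes w :: "nat \<Rightarrow> real"
  assumes rel: "\<And>r. r < n + 1 \<Longrightarrow> (\<Sum>i<n + 2. w i * hom i $ r) = 0"
  shows "\<forall>i<n + 2. w i = w 0 / b 0 * b i"
proof (intro allI impI)
  fix i assume i: "i < n + 2"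
  define u where "u j = w j - w 0 / b 0 * b j" for j
  have u0: "u 0 = 0" using coeff_nonzero[of 0] by (simp add: u_def)
  have "u i = 0"
  proof (cases "i = 0")
    case False
    have "(\<Sum>j\<in>{..<n + 2} - {0}. u j * hom j $ r) = 0" if "r < n + 1" for r
    proof -
      have "(\<Sum>j\<in>{..<n + 2} - {0}. u j * hom j $ r) = (\<Sum>j<n + 2. u j * hom j $ r)"
        using sum.remove[of "{..<n + 2}" 0 "\<lambda>j. u j * hom j $ r"] u0 by simp
      also have "\<dots> = (\<Sum>j<n + 2. w j * hom j $ r) - w 0 / b 0 * (\<Sum>j<n + 2. b j * hom j $ r)"
        unfolding sum_distrib_left sum_subtractf[symmetric] by (simp add: u_def algebra_simps)
      finally show ?thesis using rel[OF that] coeff_relation[OF that] by simp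
    qed
    then show ?thesis using omit_one_independent[of 0 u i] i False by simp
  qed (simp add: u0)
  then show "w i = w 0 / b 0 * b i" by (simp add: u_def)
qed

text \<open>The points are real, so real and imaginary parts of a relation are relations themselves;
  the explicit factor \<open>w 0 / b 0\<close> lets the two be reassembled.\<close>

lemma relation_unique_complex:
  fixes w :: "nat \<Rightarrow> complex"
  assumes rel: "\<And>r. r < n + 1 \<Longrightarrow> (\<Sum>i<n + 2. w i * of_real (hom i $ r)) = 0"
  shows "\<forall>i<n + 2. w i = w 0 / of_real (b 0) * of_real (b i)"
proof -
  have Re: "(\<Sum>i<n + 2. Re (w i) * hom i $ r) = 0" and Im: "(\<Sum>i<n + 2. Im (w i) * hom i $ r) = 0"
    if "r < n + 1" for r
    using arg_cong[OF rel[OF that], of Re] arg_cong[OF rel[OF that], of Im]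
    by (simp_all del: sum.lessThan_Suc)
  have "\<forall>i<n + 2. Re (w i) = Re (w 0) / b 0 * b i" by (rule relation_unique_real) (rule Re)
  moreover have "\<forall>i<n + 2. Im (w i) = Im (w 0) / b 0 * b i" by (rule relation_unique_real) (rule Im)
  ultimately have "Re (w i) = Re (w 0) / b 0 * b i" "Im (w i) = Im (w 0) / b 0 * b i"
    if "i < n + 2" for i
    using that by blast+
  note eq = this
  show ?thesis
  proof (intro allI impI complex_eqI)
    fix i assume "i < n + 2"
    show "Re (w i) = Re (w 0 / of_real (b 0) * of_real (b i))" by (subst eq(1)[OF \<open>i < n + 2\<close>]) simp
    show "Im (w i) = Im (w 0 / of_real (b 0) * of_real (b i))" by (subst eq(2)[OF \<open>i < n + 2\<close>]) simp
  qed
qed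

text \<open>A relation among homogenised points annihilates the values of every affine function at
  them. With \<kappa> = ln |l|, this is how l and the root drop out of the discriminant
  equation.\<close>

lemma coeff_sum_affine:
  assumes "z \<in> carrier_vec n"
  shows "(\<Sum>i<n + 2. b i * (\<kappa> + a i \<bullet> z)) = 0"
proof -
  have "b i * (\<kappa> + a i \<bullet> z) = (\<Sum>r<n + 1. b i * hom i $ r * vCons \<kappa> z $ r)" for i
    using assms sum_vCons_mult[of 1 "a i" \<kappa> z n]
    by (simp add: scalar_prod_lessThan mult.assoc flip: sum_distrib_left)
  then have "(\<Sum>i<n + 2. b i * (\<kappa> + a i \<bullet> z)) = (\<Sum>r<n + 1. (\<Sum>i<n + 2. b i * hom i $ r) * vCons \<kappa> z $ r)"
    by (simp only: sum_distrib_right) (rule sum.swap)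
  also have "\<dots> = 0" by (intro sum.neutral ballI) (simp only: coeff_relation lessThan_iff mult_zero_left)
  finally show ?thesis .
qed

text \<open>Its rows are (1, a_i) for i <= n: it maps an affine function, given by constant term and
  gradient, to its values at the first n + 1 points. Up to sign its determinant is
  \<open>b (n + 1)\<close>.\<close>

definition eval_mat :: "real mat" where
  "eval_mat = transpose_mat (point_minor n a (n + 1))"

lemma eval_mat: "eval_mat \<in> carrier_mat (n + 1) (n + 1)" "det eval_mat \<noteq> 0"
proof -
  have P: "point_minor n a (n + 1) \<in> carrier_mat (n + 1) (n + 1)" by (rule point_minor_carrier) simp
  then show "eval_mat \<in> carrier_mat (n + 1) (n + 1)" by (simp add: eval_mat_def)
  show "det eval_mat \<noteq> 0"
    using coeff_nonzero[of "n + 1"] det_transpose[OF P] by (simp add: eval_mat_def circuit_coeff_eq)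
qed

lemma eval_mat_mult:
  assumes z: "z \<in> carrier_vec n" and i: "i < n + 1"
  shows "(eval_mat *\<^sub>v vCons \<kappa> z) $ i = \<kappa> + a i \<bullet> z"
proof -
  have P: "point_minor n a (n + 1) \<in> carrier_mat (n + 1) (n + 1)" by (rule point_minor_carrier) simp
  have ent: "point_minor n a (n + 1) $$ (r,i) = hom i $ r" if "r < n + 1" for r
    using point_minor_index[of "n + 1" n r i a] that i by simp
  have "(eval_mat *\<^sub>v vCons \<kappa> z) $ i = (\<Sum>r<n + 1. point_minor n a (n + 1) $$ (r,i) * vCons \<kappa> z $ r)"
    using P z i unfolding eval_mat_def by (simp add: scalar_prod_lessThan)
  also have "\<dots> = (\<Sum>r<n + 1. hom i $ r * vCons \<kappa> z $ r)"
    by (intro sum.cong refl) (simp only: ent lessThan_iff)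
  also have "\<dots> = \<kappa> + a i \<bullet> z" using z sum_vCons_mult[of 1 "a i" \<kappa> z n] by (simp add: scalar_prod_lessThan)
  finally show ?thesis .
qed

text \<open>The first n + 1 equations are solved with the adjugate. The relation b, satisfied by
  both sides, then forces the last equation because \<open>b (n + 1)\<close> is nonzero.\<close>

lemma affine_interpolation:
  assumes "(\<Sum>i<n + 2. b i * \<rho> i) = 0"
  shows "\<exists>\<kappa> z. z \<in> carrier_vec n \<and> (\<forall>i<n + 2. \<kappa> + a i \<bullet> z = \<rho> i)"
proof -
  let ?M = eval_mat
  define v where "v = Matrix.vec (n + 1) \<rho>"
  define x where "x = (1 / det ?M) \<cdot>\<^sub>v (adj_mat ?M *\<^sub>v v)"
  have v: "v \<in> carrier_vec (n + 1)" by (simp add: v_def)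
  have adj: "adj_mat ?M \<in> carrier_mat (n + 1) (n + 1)" by (rule adj_mat(1)[OF eval_mat(1)])
  have x: "x \<in> carrier_vec (n + 1)" using adj v by (simp add: x_def)
  have "?M *\<^sub>v x = (1 / det ?M) \<cdot>\<^sub>v (?M *\<^sub>v (adj_mat ?M *\<^sub>v v))"
    unfolding x_def using eval_mat(1) adj v by (intro mult_mat_vec) auto
  also have "?M *\<^sub>v (adj_mat ?M *\<^sub>v v) = (det ?M \<cdot>\<^sub>m 1\<^sub>m (n + 1)) *\<^sub>v v"
    using assoc_mult_mat_vec[OF eval_mat(1) adj v] adj_mat(2)[OF eval_mat(1)] by simp
  also have "\<dots> = det ?M \<cdot>\<^sub>v v"
  proof (rule eq_vecI)
    fix i assume "i < dim_vec (det ?M \<cdot>\<^sub>v v)"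
    then have i: "i < n + 1" using v by simp
    have "((det ?M \<cdot>\<^sub>m 1\<^sub>m (n + 1)) *\<^sub>v v) $ i = (\<Sum>k<n + 1. (det ?M \<cdot>\<^sub>m 1\<^sub>m (n + 1)) $$ (i,k) * v $ k)"
      using v i by (auto simp: scalar_prod_lessThan simp del: sum.lessThan_Suc intro!: sum.cong)
    also have "\<dots> = (\<Sum>k<n + 1. if k = i then det ?M * v $ k else 0)"
      using i by (intro sum.cong) auto
    finally show "((det ?M \<cdot>\<^sub>m 1\<^sub>m (n + 1)) *\<^sub>v v) $ i = (det ?M \<cdot>\<^sub>v v) $ i"
      using i v by (simp add: sum.delta del: sum.lessThan_Suc)
  qed (use v in simp)
  finally have Mx: "?M *\<^sub>v x = v" using eval_mat(2) by (simp add: smult_smult_assoc)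
  obtain \<kappa> z where xz: "x = vCons \<kappa> z" "z \<in> carrier_vec n"
    using x by (cases x) auto
  have eq: "\<kappa> + a i \<bullet> z = \<rho> i" if "i < n + 1" for i
    using eval_mat_mult[OF xz(2) that, of \<kappa>] that Mx unfolding xz(1) by (simp add: v_def)
  have split: "(\<Sum>i<n + 2. f i) = (\<Sum>i<n + 1. f i) + f (n + 1)" for f :: "nat \<Rightarrow> real" by simp
  have "(\<Sum>i<n + 1. b i * (\<kappa> + a i \<bullet> z)) = (\<Sum>i<n + 1. b i * \<rho> i)"
    by (intro sum.cong refl) (simp only: eq lessThan_iff)
  then have "b (n + 1) * (\<kappa> + a (n + 1) \<bullet> z) = b (n + 1) * \<rho> (n + 1)"
    using coeff_sum_affine[OF xz(2), of \<kappa>] assms unfolding split by linarith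
  then have "\<kappa> + a (n + 1) \<bullet> z = \<rho> (n + 1)" using coeff_nonzero[of "n + 1"] by simp
  moreover have "i < n + 1 \<or> i = n + 1" if "i < n + 2" for i using that by auto
  ultimately show ?thesis using eq xz(2) by blast
qed

text \<open>The constant \<kappa> accommodates two roots with different multipliers. The difference
  of the two sides is an affine function that vanishes at n + 1 affinely independent points, so it
  is zero.\<close>

lemma affine_values_determine:
  assumes z: "z \<in> carrier_vec n" "z' \<in> carrier_vec n"
    and eq: "\<And>i. i < n + 2 \<Longrightarrow> a i \<bullet> z = \<kappa> + a i \<bullet> z'"
  shows "z = z'"
proof -
  let ?y = "vCons (- \<kappa>) (z - z')"
  have y: "?y \<in> carrier_vec (n + 1)" using z by simp
  have "eval_mat *\<^sub>v ?y = 0\<^sub>v (n + 1)"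
  proof (rule eq_vecI)
    fix i assume "i < dim_vec (0\<^sub>v (n + 1) :: real Matrix.vec)"
    then have i: "i < n + 1" by simp
    then show "(eval_mat *\<^sub>v ?y) $ i = 0\<^sub>v (n + 1) $ i"
      using eval_mat_mult[of "z - z'" i "- \<kappa>"] z eq[of i] point_carrier[of i]
      by (simp add: scalar_prod_minus_distrib)
  qed (use eval_mat(1) in auto)
  then have "?y = 0\<^sub>v (n + 1)"
    using det_0_iff_vec_prod_zero[OF eval_mat(1)] eval_mat(2) y by blast
  then have "?y $ Suc k = 0" if "k < n" for k using that by simp
  then show ?thesis using z by (intro eq_vecI) auto
qed

end

section \<open>Degenerate roots\<close>

text \<open>Differentiating exp(a_i y) in direction j multiplies it by coordinate j of a_i. So r = 0
  encodes g(y) = 0, and r = j + 1 the vanishing of the j-th partial derivative.\<close>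

lemma degenerate_root_exp_sum_iff:
  fixes c y :: "'k::{real_normed_field,banach} Matrix.vec"
  assumes c: "c \<in> carrier_vec m" and a: "\<And>i. i < m \<Longrightarrow> a i \<in> carrier_vec n"
  shows "degenerate_root n (exp_sum a c) y \<longleftrightarrow> y \<in> carrier_vec n \<and>
    (\<forall>r<n + 1. (\<Sum>i<m. c $ i * exp (map_vec of_real (a i) \<bullet> y) * of_real (vCons 1 (a i) $ r)) = 0)"
proof (cases "y \<in> carrier_vec n")
  case y: True
  let ?e = "\<lambda>i. exp (map_vec of_real (a i) \<bullet> y)"
  have deriv: "((\<lambda>t. exp_sum a c (Matrix.vec n (\<lambda>k. if k = j then t else y $ k)))
      has_field_derivative (\<Sum>i<m. c $ i * ?e i * of_real (a i $ j))) (at (y $ j))" if j: "j < n" for j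
  proof -
    define B where "B i = (\<Sum>k\<in>{..<n} - {j}. of_real (a i $ k) * y $ k)" for i
    have sp: "map_vec of_real (a i) \<bullet> Matrix.vec n (\<lambda>k. if k = j then t else y $ k) = of_real (a i $ j) * t + B i"
      if i: "i < m" for i t
    proof -
      have "map_vec of_real (a i) \<bullet> Matrix.vec n (\<lambda>k. if k = j then t else y $ k)
          = (\<Sum>k<n. of_real (a i $ k) * (if k = j then t else y $ k))"
        using a[OF i] by (auto simp: scalar_prod_lessThan intro!: sum.cong)
      also have "\<dots> = of_real (a i $ j) * t + (\<Sum>k\<in>{..<n} - {j}. of_real (a i $ k) * (if k = j then t else y $ k))"
        using j by (subst sum.remove[of _ j]) auto
      also have "(\<Sum>k\<in>{..<n} - {j}. of_real (a i $ k) * (if k = j then t else y $ k)) = B i"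
        unfolding B_def by (intro sum.cong) auto
      finally show ?thesis .
    qed
    have "Matrix.vec n (\<lambda>k. if k = j then y $ j else y $ k) = y" using y by (intro eq_vecI) auto
    then have e: "?e i = exp (of_real (a i $ j) * y $ j + B i)" if "i < m" for i
      using sp[OF that, of "y $ j"] by simp
    have "(\<lambda>t. exp_sum a c (Matrix.vec n (\<lambda>k. if k = j then t else y $ k)))
        = (\<lambda>t. \<Sum>i<m. c $ i * exp (of_real (a i $ j) * t + B i))"
      using c by (auto simp: exp_sum_def sp)
    moreover have "((\<lambda>t. \<Sum>i<m. c $ i * exp (of_real (a i $ j) * t + B i))
      has_field_derivative (\<Sum>i<m. c $ i * (exp (of_real (a i $ j) * y $ j + B i) * of_real (a i $ j)))) (at (y $ j))"
      by (rule DERIV_sum) (auto intro!: derivative_eq_intros)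
    ultimately show ?thesis by (simp add: e mult.assoc)
  qed
  have "((\<lambda>t. exp_sum a c (Matrix.vec n (\<lambda>k. if k = j then t else y $ k))) has_field_derivative 0) (at (y $ j))
      \<longleftrightarrow> (\<Sum>i<m. c $ i * ?e i * of_real (a i $ j)) = 0" if "j < n" for j
  proof
    assume "((\<lambda>t. exp_sum a c (Matrix.vec n (\<lambda>k. if k = j then t else y $ k))) has_field_derivative 0) (at (y $ j))"
    with deriv[OF that] show "(\<Sum>i<m. c $ i * ?e i * of_real (a i $ j)) = 0" by (rule DERIV_unique)
  next
    assume "(\<Sum>i<m. c $ i * ?e i * of_real (a i $ j)) = 0"
    with deriv[OF that] show
      "((\<lambda>t. exp_sum a c (Matrix.vec n (\<lambda>k. if k = j then t else y $ k))) has_field_derivative 0) (at (y $ j))"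
      by simp
  qed
  moreover have "exp_sum a c y = (\<Sum>i<m. c $ i * ?e i)" using c by (simp add: exp_sum_def)
  moreover have "(\<forall>r<n + 1. P r) \<longleftrightarrow> P 0 \<and> (\<forall>j<n. P (Suc j))" for P
    using less_Suc_eq_0_disj by auto
  ultimately show ?thesis using y by (simp add: degenerate_root_def)
qed (simp add: degenerate_root_def)

lemma map_vec_of_real_id [simp]: "map_vec of_real v = (v :: real Matrix.vec)"
  by (intro eq_vecI) auto

context point_circuit
begin

text \<open>The solutions of the n + 1 homogenised equations are the multiples of b. The multiplier
  l may still be zero here; it is excluded once c is known to be nonzero.\<close>

lemma degenerate_root_real_iff:
  fixes c z :: "real Matrix.vec"
  assumes c: "c \<in> carrier_vec (n + 2)"
  shows "degenerate_root n (exp_sum a c) z \<longleftrightarrow>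
    z \<in> carrier_vec n \<and> (\<exists>l. \<forall>i<n + 2. c $ i * exp (a i \<bullet> z) = l * b i)"
proof -
  have "(\<forall>r<n + 1. (\<Sum>i<n + 2. c $ i * exp (a i \<bullet> z) * hom i $ r) = 0) \<longleftrightarrow>
    (\<exists>l. \<forall>i<n + 2. c $ i * exp (a i \<bullet> z) = l * b i)" (is "?L \<longleftrightarrow> ?R")
  proof
    assume ?L
    then show ?R using relation_unique_real[of "\<lambda>i. c $ i * exp (a i \<bullet> z)"] by blast
  next
    assume ?R
    then obtain l where l: "\<And>i. i < n + 2 \<Longrightarrow> c $ i * exp (a i \<bullet> z) = l * b i" by blast
    show ?L
    proof (intro allI impI)
      fix r assume "r < n + 1"
      have "(\<Sum>i<n + 2. c $ i * exp (a i \<bullet> z) * hom i $ r) = l * (\<Sum>i<n + 2. b i * hom i $ r)"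
        unfolding sum_distrib_left by (intro sum.cong refl) (simp only: l lessThan_iff mult.assoc)
      then show "(\<Sum>i<n + 2. c $ i * exp (a i \<bullet> z) * hom i $ r) = 0"
        using coeff_relation[OF \<open>r < n + 1\<close>] by simp
    qed
  qed
  moreover have "degenerate_root n (exp_sum a c) z \<longleftrightarrow> z \<in> carrier_vec n \<and>
    (\<forall>r<n + 1. (\<Sum>i<n + 2. c $ i * exp (map_vec of_real (a i) \<bullet> z) * of_real (hom i $ r)) = 0)"
    by (rule degenerate_root_exp_sum_iff[OF c point_carrier])
  ultimately show ?thesis by (simp only: map_vec_of_real_id) (simp only: of_real_eq_id id_apply)
qed

lemma degenerate_root_complex:
  fixes c y :: "complex Matrix.vec"
  assumes c: "c \<in> carrier_vec (n + 2)" and root: "degenerate_root n (exp_sum a c) y"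
  shows "y \<in> carrier_vec n"
    and "\<exists>l. \<forall>i<n + 2. c $ i * exp (map_vec of_real (a i) \<bullet> y) = l * of_real (b i)"
proof -
  have y: "y \<in> carrier_vec n" and rel: "\<And>r. r < n + 1 \<Longrightarrow>
      (\<Sum>i<n + 2. c $ i * exp (map_vec of_real (a i) \<bullet> y) * of_real (hom i $ r)) = 0"
    using root degenerate_root_exp_sum_iff[where a = a, OF c point_carrier] by auto
  show "y \<in> carrier_vec n" by (rule y)
  show "\<exists>l. \<forall>i<n + 2. c $ i * exp (map_vec of_real (a i) \<bullet> y) = l * of_real (b i)"
    by (rule exI, rule relation_unique_complex, rule rel)
qed

section \<open>Real degenerate roots and the signed product equation\<close>

lemma powr_sgn_mult: "\<lbrakk>0 < x; s = 1 \<or> s = -1\<rbrakk> \<Longrightarrow> x powr (s * \<beta>) = exp (s * (\<beta> * ln x))" for x s \<beta> :: real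
  by (auto simp: powr_def)

context
  fixes c :: "real Matrix.vec"
  assumes c: "c \<in> nonzero_vecs (n + 2)"
begin

lemma c_carrier: "c \<in> carrier_vec (n + 2)"
  using c by (simp add: nonzero_vecs_def)

lemma c_nonzero: "\<exists>i<n + 2. c $ i \<noteq> 0"
proof (rule ccontr)
  assume "\<not> ?thesis"
  then have "c = 0\<^sub>v (n + 2)" using c_carrier by (intro eq_vecI) auto
  then show False using c by (simp add: nonzero_vecs_def)
qed

text \<open>If l were zero, c would be zero, as exponentials do not vanish. With l nonzero no c_i
  can vanish, since no b_i does.\<close>

lemma degenerate_root_realD:
  assumes "degenerate_root n (exp_sum a c) z"
  shows "\<exists>l. z \<in> carrier_vec n \<and> l \<noteq> 0 \<and> (\<forall>i<n + 2. c $ i \<noteq> 0 \<and> exp (a i \<bullet> z) = l * b i / c $ i)"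
proof -
  obtain l where z: "z \<in> carrier_vec n" and l: "\<forall>i<n + 2. c $ i * exp (a i \<bullet> z) = l * b i"
    using assms degenerate_root_real_iff[OF c_carrier] by blast
  have "l \<noteq> 0"
  proof
    assume "l = 0"
    then have "c $ i = 0" if "i < n + 2" for i using l that by simp
    then show False using c_nonzero by blast
  qed
  moreover have "c $ i \<noteq> 0 \<and> exp (a i \<bullet> z) = l * b i / c $ i" if i: "i < n + 2" for i
  proof -
    have eq: "c $ i * exp (a i \<bullet> z) = l * b i" using l i by blast
    then have "c $ i \<noteq> 0" using \<open>l \<noteq> 0\<close> coeff_nonzero[OF i] by auto
    then show ?thesis using eq by (simp add: eq_divide_eq mult.commute)
  qed
  ultimately show ?thesis using z by blast
qed

lemma sgn_relation:
  assumes "l \<noteq> 0" "i < n + 2" "c $ i \<noteq> 0" "exp (a i \<bullet> z) = l * b i / c $ i"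
  shows "sgn (c $ i * b i) = sgn l"
proof -
  have "0 < l * b i / c $ i" using assms(4) by (metis exp_gt_zero)
  then show ?thesis using assms(1,3) by (auto simp: sgn_if zero_less_divide_iff zero_less_mult_iff mult_less_0_iff)
qed

text \<open>For roots with multipliers l and l' the ratio of the exponentials is l / l' for every i,
  so a_i z and a_i z' differ by a constant independent of i.\<close>

lemma degenerate_root_unique:
  assumes z: "degenerate_root n (exp_sum a c) z" and z': "degenerate_root n (exp_sum a c) z'"
  shows "z = z'"
proof -
  obtain l where l: "z \<in> carrier_vec n" "l \<noteq> 0"
      "\<forall>i<n + 2. c $ i \<noteq> 0 \<and> exp (a i \<bullet> z) = l * b i / c $ i"
    using degenerate_root_realD[OF z] by blast
  obtain l' where l': "z' \<in> carrier_vec n" "l' \<noteq> 0"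
      "\<forall>i<n + 2. c $ i \<noteq> 0 \<and> exp (a i \<bullet> z') = l' * b i / c $ i"
    using degenerate_root_realD[OF z'] by blast
  have ratio: "exp (a i \<bullet> z - a i \<bullet> z') = l / l'" if "i < n + 2" for i
    unfolding exp_diff l(3)[rule_format, OF that, THEN conjunct2] l'(3)[rule_format, OF that, THEN conjunct2] using l(3)[rule_format, OF that, THEN conjunct1] l'(2) coeff_nonzero[OF that]
    by (simp add: field_simps)
  then have "a i \<bullet> z - a i \<bullet> z' = ln (l / l')" if "i < n + 2" for i
    using that by (metis ln_exp)
  then have "a i \<bullet> z = ln (l / l') + a i \<bullet> z'" if "i < n + 2" for i
    using that by (simp add: algebra_simps)
  then show ?thesis by (rule affine_values_determine[OF l(1) l'(1)])
qed

text \<open>The formula is not invariant under scaling of c. It holds for the representative t c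
  with t = 1 / |l|, whose multiplier is sgn l; by uniqueness of the root one t is enough.\<close>

lemma degenerate_root_value:
  "\<exists>t>0. \<forall>\<zeta>. degenerate_root n (exp_sum a c) \<zeta> \<longrightarrow>
     (\<forall>i<n + 2. exp (a i \<bullet> \<zeta>) = sgn (b 0 * (t * c $ 0)) * b i / (t * c $ i))"
proof (cases "\<exists>z. degenerate_root n (exp_sum a c) z")
  case True
  then obtain z where z: "degenerate_root n (exp_sum a c) z" by blast
  obtain l where l: "z \<in> carrier_vec n" "l \<noteq> 0"
      "\<forall>i<n + 2. c $ i \<noteq> 0 \<and> exp (a i \<bullet> z) = l * b i / c $ i"
    using degenerate_root_realD[OF z] by blast
  have "sgn (c $ 0 * b 0) = sgn l" by (rule sgn_relation[OF l(2)]) (use l(3) in auto)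
  then have "sgn (b 0 * (1 / \<bar>l\<bar> * c $ 0)) = sgn l"
    using l(2) by (simp add: sgn_mult mult.commute)
  then have "exp (a i \<bullet> z) = sgn (b 0 * (1 / \<bar>l\<bar> * c $ 0)) * b i / (1 / \<bar>l\<bar> * c $ i)" if "i < n + 2" for i
    using l(2) l(3)[rule_format, OF that, THEN conjunct2] by (simp add: sgn_mult_abs)
  then show ?thesis using degenerate_root_unique[OF z] l(2)
    by (intro exI[of _ "1 / \<bar>l\<bar>"]) (metis zero_less_abs_iff zero_less_divide_1_iff)
qed (auto intro: exI[of _ 1])

lemma degenerate_root_exists_iff:
  "(\<forall>i<n + 2. sgn (c $ i * b i) = sgn (c $ 0 * b 0)) \<and>
   (\<Prod>i<n + 2. (sgn (b i * c $ i) * c $ i / b i) powr (sgn (b i * c $ i) * b i)) = 1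
   \<longleftrightarrow> (\<exists>\<zeta>. degenerate_root n (exp_sum a c) \<zeta>)"
  (is "?S \<and> ?P = 1 \<longleftrightarrow> ?R")
proof -
  \<comment> \<open>A common nonzero sign s makes all bases positive, so the product equation says
    that b annihilates the vector of the ln (s c_i / b_i).\<close>
  have prod: "?P = exp (s * (\<Sum>i<n + 2. b i * ln (s * c $ i / b i)))"
    if s: "s = 1 \<or> s = -1" "\<And>i. i < n + 2 \<Longrightarrow> sgn (c $ i * b i) = s" for s
  proof -
    have "?P = (\<Prod>i<n + 2. exp (s * (b i * ln (s * c $ i / b i))))"
    proof (intro prod.cong refl)
      fix i assume "i \<in> {..<n + 2}"
      then have sgn: "sgn (b i * c $ i) = s" using s(2)[of i] by (simp add: mult.commute)
      then have "0 < s * c $ i / b i" using s(1) by (auto simp: sgn_if zero_less_mult_iff zero_less_divide_iff split: if_splits)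
      then show "(sgn (b i * c $ i) * c $ i / b i) powr (sgn (b i * c $ i) * b i) = exp (s * (b i * ln (s * c $ i / b i)))"
        unfolding sgn using s(1) by (rule powr_sgn_mult)
    qed
    then show ?thesis by (simp only: exp_sum finite_lessThan sum_distrib_left)
  qed
  show ?thesis
  proof
    assume ?R
    then obtain z where z: "degenerate_root n (exp_sum a c) z" by blast
    obtain l where l: "z \<in> carrier_vec n" "l \<noteq> 0"
      "\<forall>i<n + 2. c $ i \<noteq> 0 \<and> exp (a i \<bullet> z) = l * b i / c $ i"
    using degenerate_root_realD[OF z] by blast
    have sgn: "sgn (c $ i * b i) = sgn l" if "i < n + 2" for i
      by (rule sgn_relation[OF l(2) that l(3)[rule_format, OF that, THEN conjunct1] l(3)[rule_format, OF that, THEN conjunct2]])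
    \<comment> \<open>These logarithms are the values of one affine function at the points, which b
      annihilates.\<close>
    have "ln (sgn l * c $ i / b i) = ln \<bar>l\<bar> + - (a i \<bullet> z)" if "i < n + 2" for i
    proof -
      have "c $ i = l * b i / exp (a i \<bullet> z)"
        unfolding l(3)[rule_format, OF that, THEN conjunct2] using l(2) l(3)[rule_format, OF that, THEN conjunct1] coeff_nonzero[OF that] by simp
      then have "sgn l * c $ i / b i = \<bar>l\<bar> / exp (a i \<bullet> z)"
        using coeff_nonzero[OF that] by (simp add: abs_sgn mult.commute)
      then show ?thesis using l(2) by (simp add: ln_div)
    qed
    then have "(\<Sum>i<n + 2. b i * ln (sgn l * c $ i / b i)) = (\<Sum>i<n + 2. b i * (ln \<bar>l\<bar> + - (a i \<bullet> z)))"
      by (intro sum.cong refl) (simp only: lessThan_iff)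
    also have "\<dots> = (\<Sum>i<n + 2. b i * (ln \<bar>l\<bar> + a i \<bullet> (- z)))"
      using point_carrier l(1) by (intro sum.cong refl) auto
    also have "\<dots> = 0" by (rule coeff_sum_affine) (use l(1) in simp)
    finally have "?P = 1" using prod[of "sgn l"] sgn l(2) by (simp add: sgn_if del: prod.lessThan_Suc sum.lessThan_Suc)
    then show "?S \<and> ?P = 1" using sgn[of 0] sgn by simp
  next
    assume SP: "?S \<and> ?P = 1"
    define s where "s = sgn (c $ 0 * b 0)"
    have sgn: "sgn (c $ i * b i) = s" if "i < n + 2" for i using SP that unfolding s_def by blast
    \<comment> \<open>Equality of the signs alone admits the common sign 0, but that would force c =
      0.\<close>
    obtain i0 where "i0 < n + 2" "c $ i0 \<noteq> 0" using c_nonzero by blast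
    then have "s \<noteq> 0" using sgn[of i0] coeff_nonzero[of i0] by (auto simp: sgn_if split: if_splits)
    then have s: "s = 1 \<or> s = -1" by (auto simp: s_def sgn_if split: if_splits)
    have pos: "0 < s * b i / c $ i" if "i < n + 2" for i
      using sgn[OF that] s by (auto simp: sgn_if zero_less_mult_iff zero_less_divide_iff split: if_splits)
    have inv: "s * c $ i / b i = 1 / (s * b i / c $ i)" if "i < n + 2" for i
      using s by (auto simp: field_simps)
    have "(\<Sum>i<n + 2. b i * ln (s * c $ i / b i)) = 0" using prod[OF s sgn] SP s by auto
    moreover have "(\<Sum>i<n + 2. b i * ln (s * c $ i / b i)) = (\<Sum>i<n + 2. - (b i * ln (s * b i / c $ i)))"
    proof (intro sum.cong refl)
      fix i assume "i \<in> {..<n + 2}"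
      then have "0 < s * b i / c $ i" using pos by simp
      then show "b i * ln (s * c $ i / b i) = - (b i * ln (s * b i / c $ i))"
        using \<open>i \<in> {..<n + 2}\<close> inv[of i] ln_inverse[of "s * b i / c $ i"]
        by (simp only: lessThan_iff inverse_eq_divide mult_minus_right)
    qed
    ultimately have "(\<Sum>i<n + 2. b i * ln (s * b i / c $ i)) = 0" by (simp only: sum_negf neg_equal_0_iff_equal)
    then obtain \<kappa> z where z: "z \<in> carrier_vec n" "\<And>i. i < n + 2 \<Longrightarrow> \<kappa> + a i \<bullet> z = ln (s * b i / c $ i)"
      using affine_interpolation[of "\<lambda>i. ln (s * b i / c $ i)"] by blast
    \<comment> \<open>The constant term \<kappa> of the interpolating function goes into the
      multiplier l = s exp(- \<kappa>).\<close>
    have "c $ i * exp (a i \<bullet> z) = (s * exp (- \<kappa>)) * b i" if "i < n + 2" for i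
    proof -
      have "a i \<bullet> z = - \<kappa> + ln (s * b i / c $ i)" using z(2)[OF that] by simp
      then have "exp (a i \<bullet> z) = exp (- \<kappa>) * (s * b i / c $ i)" using pos[OF that] by (simp only: exp_add exp_ln)
      moreover have "c $ i \<noteq> 0" using pos[OF that] by auto
      ultimately show ?thesis by simp
    qed
    then show ?R using z(1) degenerate_root_real_iff[OF c_carrier] by blast
  qed
qed

end

end

section \<open>The discriminant locus\<close>

text \<open>The cleared form is taken at every point, also where no coordinate vanishes. All its
  exponents are positive, so both sides stay continuous up to the coordinate hyperplanes.\<close>

definition cleared_disc_equation :: "(nat \<Rightarrow> real) \<Rightarrow> complex Matrix.vec \<Rightarrow> bool" where
  "cleared_disc_equation \<beta> c \<longleftrightarrow>
     (\<Prod>i\<in>{i. i < dim_vec c \<and> \<beta> i > 0}. cmod (c $ i / of_real (\<beta> i)) powr \<beta> i) =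
     (\<Prod>i\<in>{i. i < dim_vec c \<and> \<beta> i < 0}. cmod (c $ i / of_real (\<beta> i)) powr (- \<beta> i))"

lemma disc_equation_iff_cleared:
  assumes nz: "\<And>i. i < dim_vec c \<Longrightarrow> \<beta> i \<noteq> 0"
  shows "disc_equation \<beta> c \<longleftrightarrow> cleared_disc_equation \<beta> c"
proof (cases "\<forall>i<dim_vec c. c $ i \<noteq> 0")
  case True
  let ?f = "\<lambda>i. cmod (c $ i / of_real (\<beta> i))"
  let ?P = "{i. i < dim_vec c \<and> \<beta> i > 0}" and ?N = "{i. i < dim_vec c \<and> \<beta> i < 0}"
  have pos: "0 < ?f i powr x" if "i \<in> ?N" for i x using True nz that by auto
  have "(\<Prod>i<dim_vec c. ?f i powr \<beta> i) = (\<Prod>i\<in>?P \<union> ?N. ?f i powr \<beta> i)"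
    using nz by (intro prod.cong) (auto simp: neq_iff)
  also have "\<dots> = (\<Prod>i\<in>?P. ?f i powr \<beta> i) * (\<Prod>i\<in>?N. ?f i powr \<beta> i)"
    by (rule prod.union_disjoint) auto
  also have "(\<Prod>i\<in>?N. ?f i powr \<beta> i) = inverse (\<Prod>i\<in>?N. ?f i powr (- \<beta> i))"
    unfolding prod_inversef[symmetric] by (intro prod.cong refl) (simp add: powr_minus)
  finally have "(\<Prod>i<dim_vec c. ?f i powr \<beta> i)
      = (\<Prod>i\<in>?P. ?f i powr \<beta> i) / (\<Prod>i\<in>?N. ?f i powr (- \<beta> i))"
    by (simp only: divide_inverse)
  moreover have "0 < (\<Prod>i\<in>?N. ?f i powr (- \<beta> i))" by (intro prod_pos ballI pos)
  ultimately show ?thesis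
    using True unfolding disc_equation_def cleared_disc_equation_def by (simp add: divide_eq_eq)
qed (auto simp: disc_equation_def cleared_disc_equation_def)

text \<open>Scaling by t multiplies the sides by |t| to the sum of the positive \<beta>_i and to
  minus the sum of the negative ones; these exponents agree because the total is zero.\<close>

lemma cleared_disc_equation_smult:
  assumes c: "dim_vec c = m" and sum: "(\<Sum>i<m. \<beta> i) = 0" and t: "t \<noteq> 0"
  shows "cleared_disc_equation \<beta> (t \<cdot>\<^sub>v c) \<longleftrightarrow> cleared_disc_equation \<beta> c"
proof -
  let ?P = "{i. i < m \<and> \<beta> i > 0}" and ?N = "{i. i < m \<and> \<beta> i < 0}"
  have scale: "(\<Prod>i\<in>I. cmod ((t \<cdot>\<^sub>v c) $ i / of_real (\<beta> i)) powr \<gamma> i)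
      = cmod t powr (\<Sum>i\<in>I. \<gamma> i) * (\<Prod>i\<in>I. cmod (c $ i / of_real (\<beta> i)) powr \<gamma> i)"
    if "I \<subseteq> {..<m}" for I \<gamma>
  proof -
    have "finite I" using that by (rule finite_subset) simp
    have "(\<Prod>i\<in>I. cmod ((t \<cdot>\<^sub>v c) $ i / of_real (\<beta> i)) powr \<gamma> i)
        = (\<Prod>i\<in>I. cmod t powr \<gamma> i * cmod (c $ i / of_real (\<beta> i)) powr \<gamma> i)"
      using that c by (intro prod.cong refl)
        (auto simp: norm_mult norm_divide simp flip: powr_mult)
    also have "\<dots> = (\<Prod>i\<in>I. cmod t powr \<gamma> i) * (\<Prod>i\<in>I. cmod (c $ i / of_real (\<beta> i)) powr \<gamma> i)"
      by (rule prod.distrib)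
    also have "(\<Prod>i\<in>I. cmod t powr \<gamma> i) = cmod t powr (\<Sum>i\<in>I. \<gamma> i)"
      using t \<open>finite I\<close> by (simp add: powr_sum)
    finally show ?thesis .
  qed
  have "(\<Sum>i<m. \<beta> i) = (\<Sum>i\<in>?P \<union> ?N. \<beta> i)"
    by (rule sum.mono_neutral_right) (auto simp: neq_iff)
  also have "\<dots> = (\<Sum>i\<in>?P. \<beta> i) + (\<Sum>i\<in>?N. \<beta> i)" by (rule sum.union_disjoint) auto
  finally have "(\<Sum>i\<in>?N. - \<beta> i) = (\<Sum>i\<in>?P. \<beta> i)" using sum by (simp add: sum_negf)
  moreover have "?P \<subseteq> {..<m}" "?N \<subseteq> {..<m}" by auto
  ultimately show ?thesis
    unfolding cleared_disc_equation_def index_smult_vec(2) c using t by (simp only: scale) simp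
qed

lemma continuous_map_vec_index:
  assumes "i < m"
  shows "continuous_map (nonzero_vecs_topology m) euclidean (\<lambda>v. v $ i)"
proof -
  let ?r = "\<lambda>v. restrict (vec_index v) {..<m}"
  have "continuous_map (nonzero_vecs_topology m) (product_topology (\<lambda>_. euclidean) {..<m}) (id \<circ> ?r)"
    unfolding nonzero_vecs_topology_def by (rule continuous_map_pullback) (rule continuous_map_id)
  then have "continuous_map (nonzero_vecs_topology m) euclidean
      ((\<lambda>x. x i) \<circ> (id \<circ> ?r))"
    by (rule continuous_map_compose) (use assms in \<open>auto intro: continuous_map_product_projection\<close>)
  then show ?thesis by (rule continuous_map_eq) (use assms in simp)
qed

text \<open>Strictly positive exponents make x powr \<gamma> continuous at x = 0 too.\<close>

lemma continuous_map_weighted_prod: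
  assumes "I \<subseteq> {..<m}" "\<And>i. i \<in> I \<Longrightarrow> 0 < \<gamma> i" "\<And>i. i \<in> I \<Longrightarrow> \<beta> i \<noteq> 0"
  shows "continuous_map (nonzero_vecs_topology m) euclidean
    (\<lambda>v. \<Prod>i\<in>I. cmod (v $ i / of_real (\<beta> i)) powr \<gamma> i)"
proof (rule continuous_map_prod)
  show "finite I" using assms(1) by (rule finite_subset) simp
  fix i assume i: "i \<in> I"
  then have "i < m" using assms(1) by auto
  have "continuous_on UNIV (\<lambda>z. cmod (z / of_real (\<beta> i)) powr \<gamma> i)"
    using assms(2,3)[OF i] by (intro continuous_on_powr' continuous_intros) auto
  then have "continuous_map euclidean euclidean (\<lambda>z. cmod (z / of_real (\<beta> i)) powr \<gamma> i)" by simp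
  from continuous_map_compose[OF continuous_map_vec_index[OF \<open>i < m\<close>] this]
  show "continuous_map (nonzero_vecs_topology m) euclidean (\<lambda>v. cmod (v $ i / of_real (\<beta> i)) powr \<gamma> i)"
    by (simp add: comp_def)
qed

lemma closedin_cleared_disc_equation:
  "closedin (nonzero_vecs_topology m) {v \<in> nonzero_vecs m. cleared_disc_equation \<beta> v}"
proof -
  let ?P = "\<lambda>v. \<Prod>i\<in>{i. i < m \<and> \<beta> i > 0}. cmod (v $ i / of_real (\<beta> i)) powr \<beta> i"
  let ?N = "\<lambda>v. \<Prod>i\<in>{i. i < m \<and> \<beta> i < 0}. cmod (v $ i / of_real (\<beta> i)) powr (- \<beta> i)"
  have "continuous_map (nonzero_vecs_topology m) euclidean ?P"
    "continuous_map (nonzero_vecs_topology m) euclidean ?N"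
    by (rule continuous_map_weighted_prod; auto)+
  then have "closedin (nonzero_vecs_topology m) {v \<in> topspace (nonzero_vecs_topology m). ?P v - ?N v \<in> {0}}"
    by (intro closedin_continuous_map_preimage[where Y = euclidean] continuous_map_diff) auto
  moreover have "{v \<in> topspace (nonzero_vecs_topology m). ?P v - ?N v \<in> {0}}
      = {v \<in> nonzero_vecs m. cleared_disc_equation \<beta> v}"
    by (auto simp: cleared_disc_equation_def nonzero_vecs_def)
  ultimately show ?thesis by simp
qed

lemma proj_point_eqD: "proj_point v = proj_point c \<Longrightarrow> \<exists>t. t \<noteq> 0 \<and> v = t \<cdot>\<^sub>v c"
proof -
  assume "proj_point v = proj_point c"
  moreover have "v = 1 \<cdot>\<^sub>v v" by simp
  then have "v \<in> proj_point v" unfolding proj_point_def by (metis (mono_tags, lifting) mem_Collect_eq zero_neq_one)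
  ultimately show ?thesis by (auto simp: proj_point_def)
qed

section \<open>Passage from degenerate roots to their projective closure\<close>

context point_circuit
begin

lemma coeff_sum_zero: "(\<Sum>i<n + 2. b i) = 0"
  using coeff_relation[of 0] by simp

text \<open>In the quotient topology closedness is tested on the preimage among the nonzero vectors,
  and scaling invariance identifies this preimage with the cleared locus.\<close>

lemma closedin_discriminant_locus:
  "closedin (proj_topology (n + 2)) {proj_point c | c. c \<in> nonzero_vecs (n + 2) \<and> disc_equation b c}"
  (is "closedin _ ?S")
proof -
  let ?m = "n + 2"
  have iff: "disc_equation b c \<longleftrightarrow> cleared_disc_equation b c" if "c \<in> nonzero_vecs ?m" for c
    by (rule disc_equation_iff_cleared) (use that coeff_nonzero in \<open>auto simp: nonzero_vecs_def\<close>)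
  have "{v \<in> nonzero_vecs ?m. proj_point v \<in> ?S} = {v \<in> nonzero_vecs ?m. cleared_disc_equation b v}"
  proof (intro Collect_cong conj_cong refl iffI)
    fix v :: "complex Matrix.vec" assume v: "v \<in> nonzero_vecs ?m"
    assume "proj_point v \<in> ?S"
    then obtain c where c: "c \<in> nonzero_vecs ?m" "disc_equation b c" "proj_point v = proj_point c" by blast
    then obtain t where t: "t \<noteq> 0" "v = t \<cdot>\<^sub>v c" using proj_point_eqD by blast
    have dim: "dim_vec c = ?m" using c(1) by (auto simp: nonzero_vecs_def)
    show "cleared_disc_equation b v"
      unfolding t(2) cleared_disc_equation_smult[OF dim coeff_sum_zero t(1)]
      using c(2) iff[OF c(1)] by blast
  next
    fix v :: "complex Matrix.vec" assume "v \<in> nonzero_vecs ?m" "cleared_disc_equation b v"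
    then show "proj_point v \<in> ?S" using iff by blast
  qed
  then have "closedin (nonzero_vecs_topology ?m)
      {v \<in> topspace (nonzero_vecs_topology ?m). proj_point v \<in> ?S}"
    using closedin_cleared_disc_equation[of ?m b] by simp
  moreover have "?S \<subseteq> topspace (proj_topology ?m)" by (auto simp: proj_space_def)
  ultimately show ?thesis
    using quotient_map_proj_point[of ?m] unfolding quotient_map_closedin by blast
qed

text \<open>Since the a_i are real, |exp(a_i y)| depends only on Re y. So ln |c_i / b_i| is the
  affine expression ln |l| - a_i Re y, and b annihilates its values.\<close>

lemma disc_equation_degenerate_root:
  fixes c y :: "complex Matrix.vec"
  assumes c: "c \<in> carrier_vec (n + 2)" "\<forall>i<n + 2. c $ i \<noteq> 0"
    and root: "degenerate_root n (exp_sum a c) y"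
  shows "disc_equation b c"
proof -
  have y: "y \<in> carrier_vec n" by (rule degenerate_root_complex(1)[OF c(1) root])
  obtain l where l: "\<forall>i<n + 2. c $ i * exp (map_vec of_real (a i) \<bullet> y) = l * of_real (b i)"
    using degenerate_root_complex(2)[OF c(1) root] by blast
  have "l \<noteq> 0" using l[rule_format, of 0] c(2)[rule_format, of 0] by auto
  define x where "x = map_vec Re y"
  have x: "x \<in> carrier_vec n" using y by (simp add: x_def)
  have Re: "Re (map_vec of_real (a i) \<bullet> y) = a i \<bullet> x" if "i < n + 2" for i
    using y point_carrier[OF that] by (simp add: scalar_prod_lessThan x_def)
  have "cmod (c $ i / of_real (b i)) powr b i = exp (b i * (ln (cmod l) + a i \<bullet> (- x)))"
    if i: "i < n + 2" for i
  proof -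
    have "c $ i / of_real (b i) = l / exp (map_vec of_real (a i) \<bullet> y)"
      using l[rule_format, OF i] coeff_nonzero[OF i] by (simp add: field_simps)
    then have "cmod (c $ i / of_real (b i)) = cmod l / exp (a i \<bullet> x)"
      by (simp only: norm_divide norm_exp_eq_Re Re[OF i])
    also have "\<dots> = exp (ln (cmod l) + a i \<bullet> (- x))"
      using \<open>l \<noteq> 0\<close> x point_carrier[OF i] by (simp add: exp_diff)
    finally show ?thesis by (simp add: powr_def)
  qed
  then have "(\<Prod>i<n + 2. cmod (c $ i / of_real (b i)) powr b i)
      = (\<Prod>i<n + 2. exp (b i * (ln (cmod l) + a i \<bullet> (- x))))"
    by (intro prod.cong refl) (simp only: lessThan_iff)
  also have "\<dots> = exp (\<Sum>i<n + 2. b i * (ln (cmod l) + a i \<bullet> (- x)))" by (simp only: exp_sum finite_lessThan)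
  also have "\<dots> = 1"
    using coeff_sum_affine[of "- x" "ln (cmod l)"] x by (simp del: sum.lessThan_Suc)
  finally show ?thesis using c by (simp add: disc_equation_def del: prod.lessThan_Suc)
qed

lemma gen_discriminant_subset:
  "gen_discriminant n (n + 2) a \<subseteq> {proj_point c | c. c \<in> nonzero_vecs (n + 2) \<and> disc_equation b c}"
  unfolding gen_discriminant_def
proof (rule closure_of_minimal[OF _ closedin_discriminant_locus], clarify)
  fix c y :: "complex Matrix.vec" assume c: "c \<in> carrier_vec (n + 2)" "\<forall>i<n + 2. c $ i \<noteq> 0"
    and root: "degenerate_root n (exp_sum a c) y"
  have "c \<in> nonzero_vecs (n + 2)" using c by (auto simp: nonzero_vecs_def)
  with disc_equation_degenerate_root[OF c root]
  show "\<exists>c'. proj_point c = proj_point c' \<and> c' \<in> nonzero_vecs (n + 2) \<and> disc_equation b c'" by blast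
qed

end

theorem theorem2p9:
  fixes n :: nat and A :: "real Matrix.vec set" and a :: "nat \<Rightarrow> real Matrix.vec"
    and b :: "nat \<Rightarrow> real"
  assumes A: "A = a ` {..<n + 2}" and card: "card A = n + 2"
    and circuit: "nondegenerate_circuit n A"
    and b: "b = circuit_coeff n a"
  shows "(gen_discriminant n (n + 2) a \<subseteq>
            {proj_point c | c. c \<in> nonzero_vecs (n + 2) \<and> disc_equation b c}
          \<and> NC_R 2 circuit_coeff_graph)
       \<and> (\<forall>c :: real Matrix.vec. c \<in> nonzero_vecs (n + 2) \<longrightarrow>
            ((\<forall>i<n + 2. sgn (c $ i * b i) = sgn (c $ 0 * b 0)) \<and>
             (\<Prod>i<n + 2. (sgn (b i * c $ i) * c $ i / b i) powr (sgn (b i * c $ i) * b i)) = 1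
             \<longleftrightarrow> (\<exists>\<zeta>. degenerate_root n (exp_sum a c) \<zeta>))
          \<and> (\<exists>t>0. \<forall>\<zeta>. degenerate_root n (exp_sum a c) \<zeta> \<longrightarrow>
               (\<forall>i<n + 2. exp (scalar_prod (a i) \<zeta>) =
                  sgn (b 0 * (t * c $ 0)) * b i / (t * c $ i)))
          \<and> (\<exists>\<^sub>\<le>\<^sub>1\<zeta>. degenerate_root n (exp_sum a c) \<zeta>))"
proof -
  have "inj_on a {..<n + 2}" using card unfolding A by (intro eq_card_imp_inj_on) auto
  moreover have "nondegenerate_circuit n (a ` {..<n + 2})" using circuit by (simp only: A)
  ultimately interpret point_circuit n a by (rule point_circuit.intro)
  show ?thesis unfolding b
  proof (intro conjI allI impI)
    fix c :: "real Matrix.vec" assume c: "c \<in> nonzero_vecs (n + 2)"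
    show "\<exists>\<^sub>\<le>\<^sub>1\<zeta>. degenerate_root n (exp_sum a c) \<zeta>"
      by (rule Uniq_I) (rule degenerate_root_unique[OF c])
  qed (rule gen_discriminant_subset NC_R_circuit_coeff degenerate_root_exists_iff degenerate_root_value; assumption?)+
qed

end
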